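(* Let $\gamma_I>0$ and $\gamma_T>0$. Let $\tilde g=(\tilde g_{i,j})$ be a field of symmetric positive definite $2\times 2$ matrices and $\tilde b=(\tilde b_{i,j})$ a real array. Assume that $(\tilde\rho,\tilde m)$ is the Nash equilibrium for $(\tilde g,\tilde b)$, i.e. $(\tilde\rho,\tilde m)$ is the minimizer of $\mathcal L_{\mathcal G}(\cdot,\cdot;\tilde g,\tilde b)$ over $\mathcal C_{\mathcal G}(\mu_0)$, and that all entries of $\tilde\rho$ are strictly positive. Let $\tilde\phi$ be a corresponding multiplier, i.e. $\mathcal Y(\tilde\rho,\tilde m,\tilde\phi;\tilde g,\tilde b)=0$. Then there exist $r_u>0$, $r_l>0$ and a mapping $\mathscr T$ defined on the open ball $B_{r_u}(\tilde g,\tilde b)$ of radius $r_u$ centered at $(\tilde g,\tilde b)$ such that: 1. For every $(g,b)\in B_{r_u}(\tilde g,\tilde b)$, there is a unique $(\rho,m,\phi)$ in the open ball $B_{r_l}(\tilde\rho,\tilde m,\tilde\phi)$ that solves the forward problem with objective $\mathcal L_{\mathcal G}(\cdot,\cdot;g,b)$, namely $(\rho,m,\phi)=\mathscr T(g,b)$. 2. $\mathscr T(\tilde g,\tilde b)=(\tilde\rho,\tilde m,\tilde\phi)$, $\mathscr T$ is of class $C^1$, and for all $(g,b)\in B_{r_u}(\tilde g,\tilde b)$ $$D\mathscr T(g,b)=-\bigl(D_{(\rho,m,\phi)}\mathcal Y(\mathscr T(g,b);g,b)\bigr)^{-1}\,D_{(g,b)}\mathcal Y(\mathscr T(g,b)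;g,b).$$
   Context: Discretization (space dimension $2$). Fix integers $n_x,n_y\ge 2$, $n_t\ge 1$ and set $\Delta x=1/n_x$, $\Delta y=1/n_y$, $\Delta t=1/n_t$. Indices: $1\le i\le n_x$, $1\le j\le n_y$, $1\le k\le n_t$ unless otherwise said. The unknowns are real arrays $\rho=(\rho_{i,j,k+1/2})$; $m=(m^x,m^y)$ with $m^x=(m^x_{i+1/2,j,k})$ for $1\le i\le n_x-1$, and $m^y=(m^y_{i,j+1/2,k})$ for $1\le j\le n_y-1$; and the multiplier $\phi=(\phi_{i,j,k})$. Data: an entrywise nonnegative array $\mu_0=((\mu_0)_{i,j})$, an entrywise positive array $\mu_1=((\mu_1)_{i,j})$, and weights $\gamma_I,\gamma_T$. Conventions: $\rho_{i,j,1/2}:=(\mu_0)_{i,j}$, $m^x_{1/2,j,k}=m^x_{n_x+1/2,j,k}:=0$, $m^y_{i,1/2,k}=m^y_{i,n_y+1/2,k}:=0$. Interpolations: $\bar\rho_{i,j,k}=\frac12(\rho_{i,j,k-1/2}+\rho_{i,j,k+1/2})$, $\overline{m^x}_{i,j,k}=\frac12(m^x_{i-1/2,j,k}+m^x_{i+1/2,j,k})$, $\overline{m^y}_{i,j,k}=\frac12(m^y_{i,j-1/2,k}+m^y_{i,j+1/2,k})$, $\bar m=(\overline{m^x},\overline{m^y})^\top$. Differences: $(D_t(\rho;\mu_0))_{i,j,k}=\frac1{\Delta t}(\rho_{i,j,k+1/2}-\rho_{i,j,k-1/2})$, $(D_x m^x)_{i,j,k}=\frac1{\Delta x}(m^x_{i+1/2,j,k}-m^x_{i-1/2,j,k})$,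 $(D_y m^y)_{i,j,k}=\frac1{\Delta y}(m^y_{i,j+1/2,k}-m^y_{i,j-1/2,k})$. Constraint set: $\mathcal C_{\mathcal G}(\mu_0)=\{(\rho,m): D_t(\rho;\mu_0)+D_xm^x+D_ym^y=0\}$. Parameters: $g=(g_{i,j})$, a field of symmetric $2\times2$ matrices with entries $g_{xx},g_{xy},g_{yy}$, and a real array $b=(b_{i,j})$; $(g,b)$ is viewed as a vector in $\mathbb R^{4n_xn_y}$ and $(\rho,m,\phi)$ as a vector in Euclidean space; balls are with respect to these spaces. Objective, defined for $\rho$ with all entries positive: $$\mathcal L_{\mathcal G}(\rho,m;g,b)=\Delta x\Delta y\Delta t\sum_{i,j,k}\Bigl(\frac{\bar m_{i,j,k}^\top g_{i,j}\bar m_{i,j,k}}{2\bar\rho_{i,j,k}}+\gamma_I\bar\rho_{i,j,k}\log\bar\rho_{i,j,k}\Bigr)+\Delta x\Delta y\Delta t\sum_{i,j,k}\rho_{i,j,k+1/2}\,b_{i,j}+\gamma_T\Delta x\Delta y\sum_{i,j}\rho_{i,j,n_t+1/2}\bigl(\log\rho_{i,j,n_t+1/2}-\log(\mu_1)_{i,j}\bigr).$$ The forward problem is to minimize $\mathcal L_{\mathcal G}(\rho,m;g,b)$ over $(\rho,m)\in\mathcal C_{\mathcal G}(\mu_0)$ (with $\rho$ entrywise positive). Adjoint operators on arrays $\phi$ indexed by $(i,j,k)$: $(I_t^*\phi)_{i,j,k+1/2}=\frac12(\phi_{i,j,k}+\phi_{i,j,k+1})$ for $k<n_t$ and $\frac12\phi_{i,j,n_t}$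 for $k=n_t$; $(I_x^*\phi)_{i+1/2,j,k}=\frac12(\phi_{i,j,k}+\phi_{i+1,j,k})$; $(I_y^*\phi)_{i,j+1/2,k}=\frac12(\phi_{i,j,k}+\phi_{i,j+1,k})$; $(D_t^*\phi)_{i,j,k+1/2}=-\frac1{\Delta t}(\phi_{i,j,k+1}-\phi_{i,j,k})$ for $k<n_t$ and $\frac1{\Delta t}\phi_{i,j,n_t}$ for $k=n_t$; $(D_x^*\phi)_{i+1/2,j,k}=-\frac1{\Delta x}(\phi_{i+1,j,k}-\phi_{i,j,k})$; $(D_y^*\phi)_{i,j+1/2,k}=-\frac1{\Delta y}(\phi_{i,j+1,k}-\phi_{i,j,k})$. The map $\mathcal Y=(\mathcal Y_\rho,\mathcal Y_{m^x},\mathcal Y_{m^y},\mathcal Y_\phi)$ (all products and quotients pointwise): $(\mathcal Y_\rho)_{i,j,k+1/2}=-(D_t^*\phi)_{i,j,k+1/2}+\Bigl(I_t^*\bigl(-\tfrac{\bar m^\top g\bar m}{2\bar\rho^2}+\gamma_I(\log\bar\rho+1)\bigr)\Bigr)_{i,j,k+1/2}+b_{i,j}+\delta_{k,n_t}\frac{\gamma_T}{\Delta t}\bigl(\log\rho_{i,j,n_t+1/2}-\log(\mu_1)_{i,j}+1\bigr)$, where $\delta_{k,n_t}$ is $1$ if $k=n_t$ and $0$ otherwise; $\mathcal Y_{m^x}=-D_x^*\phi+I_x^*\bigl(\tfrac{g_{xx}\overline{m^x}+g_{xy}\overline{m^y}}{\bar\rho}\bigr)$; $\mathcal Y_{m^y}=-D_y^*\phi+I_y^*\bigl(\tfrac{g_{xy}\overline{m^x}+g_{yy}\overline{m^y}}{\bar\rho}\bigr)$;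 $\mathcal Y_\phi=D_t(\rho;\mu_0)+D_xm^x+D_ym^y$. A triple $(\rho,m,\phi)$ is said to solve the forward problem for $(g,b)$ if $\rho$ is entrywise positive, $(\rho,m)$ minimizes $\mathcal L_{\mathcal G}(\cdot,\cdot;g,b)$ over $\mathcal C_{\mathcal G}(\mu_0)$, and $\phi$ is a corresponding Lagrange multiplier, i.e. $\mathcal Y(\rho,m,\phi;g,b)=0$. *)

theory Defs
  imports "HOL-Analysis.Analysis"
begin

text \<open>
  The grid sizes \<open>nx\<close>, \<open>ny\<close>, \<open>nt\<close> are the cardinalities of three finite types \<open>'x\<close>, \<open>'y\<close>, \<open>'t\<close>,
  which serve only as names for these numbers.  All arrays are Cartesian vectors over the index
  types below, so the norm of the library on vectors and pairs is the Euclidean norm of all entries.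
\<close>

text \<open>The indices \<open>1, \<dots>, n\<close>.  For \<open>\<rho>\<close> the time index \<open>k\<close> stands for \<open>k + 1/2\<close>.\<close>

typedef ('n::finite) cell = "{1..CARD('n)}"
proof -
  have "Suc 0 \<le> CARD('n)" by (simp add: Suc_le_eq)
  then show ?thesis by auto
qed

text \<open>
  The interior interfaces \<open>i + 1/2\<close> with \<open>1 \<le> i \<le> n - 1\<close>, given by \<open>i\<close>.  Types being
  nonempty, a dummy element is needed for \<open>n = 1\<close>; for \<open>n \<ge> 2\<close> the set is \<open>{1..n - 1}\<close>.
\<close>

typedef ('n::finite) face = "{1..max 1 (CARD('n) - 1)}"
  by auto

instance cell :: (finite) finite
proof
  have "(UNIV :: 'a cell set) = Abs_cell ` {1..CARD('a)}"
    by (metis type_definition.Abs_image type_definition_cell)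
  then show "finite (UNIV :: 'a cell set)" by (metis finite_imageI finite_atLeastAtMost)
qed

instance face :: (finite) finite
proof
  have "(UNIV :: 'a face set) = Abs_face ` {1..max 1 (CARD('a) - 1)}"
    by (metis type_definition.Abs_image type_definition_face)
  then show "finite (UNIV :: 'a face set)" by (metis finite_imageI finite_atLeastAtMost)
qed

type_synonym ('x, 'y) field = "real ^ 'y cell ^ 'x cell"
type_synonym ('x, 'y, 't) arr = "real ^ 't cell ^ 'y cell ^ 'x cell"
type_synonym ('x, 'y, 't) arr_x = "real ^ 't cell ^ 'y cell ^ 'x face"
type_synonym ('x, 'y, 't) arr_y = "real ^ 't cell ^ 'y face ^ 'x cell"
type_synonym ('x, 'y, 't) mom = "('x, 'y, 't) arr_x \<times> ('x, 'y, 't) arr_y"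

text \<open>A metric is given by its entries \<open>(g\<^sub>x\<^sub>x, g\<^sub>x\<^sub>y, g\<^sub>y\<^sub>y)\<close>, a parameter is \<open>(g, b)\<close>, and an unknown
  is \<open>(\<rho>, m, \<phi>)\<close> with \<open>m = (m\<^sup>x, m\<^sup>y)\<close>.\<close>

type_synonym ('x, 'y) metric = "('x, 'y) field \<times> ('x, 'y) field \<times> ('x, 'y) field"
type_synonym ('x, 'y) param = "('x, 'y) metric \<times> ('x, 'y) field"
type_synonym ('x, 'y, 't) unknown = "('x, 'y, 't) arr \<times> ('x, 'y, 't) mom \<times> ('x, 'y, 't) arr"

definition mesh :: "'n itself \<Rightarrow> real" where
  "mesh _ = 1 / real CARD('n)"

definition succ_cell :: "'n::finite cell \<Rightarrow> 'n cell" where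
  "succ_cell k = Abs_cell (Suc (Rep_cell k))"  \<comment> \<open>only meaningful for \<open>k < n\<close>\<close>

definition last_cell :: "'n::finite cell" where
  "last_cell = Abs_cell CARD('n)"

text \<open>The two cells adjacent to the interface \<open>i + 1/2\<close>.\<close>

definition lower_cell :: "'n::finite face \<Rightarrow> 'n cell" where
  "lower_cell i = Abs_cell (Rep_face i)"

definition upper_cell :: "'n::finite face \<Rightarrow> 'n cell" where
  "upper_cell i = Abs_cell (Suc (Rep_face i))"


text \<open>The natural number argument \<open>k\<close> below stands for the half integer \<open>k + 1/2\<close>; these functions
  incorporate the initial value of \<open>\<rho>\<close> and the no-flux boundary values of \<open>m\<close>.\<close>

definition rho_at :: "('x::finite, 'y::finite) field \<Rightarrow> ('x, 'y, 't::finite) arr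
    \<Rightarrow> 'x cell \<Rightarrow> 'y cell \<Rightarrow> nat \<Rightarrow> real" where
  "rho_at \<mu>0 \<rho> i j k = (if k = 0 then \<mu>0 $ i $ j else \<rho> $ i $ j $ Abs_cell k)"

definition mx_at :: "('x::finite, 'y::finite, 't::finite) arr_x
    \<Rightarrow> nat \<Rightarrow> 'y cell \<Rightarrow> 't cell \<Rightarrow> real" where
  "mx_at mx i j k = (if i = 0 \<or> i = CARD('x) then 0 else mx $ Abs_face i $ j $ k)"

definition my_at :: "('x::finite, 'y::finite, 't::finite) arr_y
    \<Rightarrow> 'x cell \<Rightarrow> nat \<Rightarrow> 't cell \<Rightarrow> real" where
  "my_at my i j k = (if j = 0 \<or> j = CARD('y) then 0 else my $ i $ Abs_face j $ k)"


definition rho_bar :: "('x::finite, 'y::finite) field \<Rightarrow> ('x, 'y, 't::finite) arr \<Rightarrow> ('x, 'y, 't) arr"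
  where "rho_bar \<mu>0 \<rho> =
    (\<chi> i j k. (rho_at \<mu>0 \<rho> i j (Rep_cell k - 1) + rho_at \<mu>0 \<rho> i j (Rep_cell k)) / 2)"

definition mx_bar :: "('x::finite, 'y::finite, 't::finite) arr_x \<Rightarrow> ('x, 'y, 't) arr" where
  "mx_bar mx = (\<chi> i j k. (mx_at mx (Rep_cell i - 1) j k + mx_at mx (Rep_cell i) j k) / 2)"

definition my_bar :: "('x::finite, 'y::finite, 't::finite) arr_y \<Rightarrow> ('x, 'y, 't) arr" where
  "my_bar my = (\<chi> i j k. (my_at my i (Rep_cell j - 1) k + my_at my i (Rep_cell j) k) / 2)"

definition m_bar :: "('x::finite, 'y::finite, 't::finite) mom
    \<Rightarrow> 'x cell \<Rightarrow> 'y cell \<Rightarrow> 't cell \<Rightarrow> real ^ 2" where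
  "m_bar m i j k = vector [mx_bar (fst m) $ i $ j $ k, my_bar (snd m) $ i $ j $ k]"


definition D_t :: "('x::finite, 'y::finite) field \<Rightarrow> ('x, 'y, 't::finite) arr \<Rightarrow> ('x, 'y, 't) arr"
  where "D_t \<mu>0 \<rho> =
    (\<chi> i j k. (rho_at \<mu>0 \<rho> i j (Rep_cell k) - rho_at \<mu>0 \<rho> i j (Rep_cell k - 1)) / mesh TYPE('t))"

definition D_x :: "('x::finite, 'y::finite, 't::finite) arr_x \<Rightarrow> ('x, 'y, 't) arr" where
  "D_x mx = (\<chi> i j k. (mx_at mx (Rep_cell i) j k - mx_at mx (Rep_cell i - 1) j k) / mesh TYPE('x))"

definition D_y :: "('x::finite, 'y::finite, 't::finite) arr_y \<Rightarrow> ('x, 'y, 't) arr" where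
  "D_y my = (\<chi> i j k. (my_at my i (Rep_cell j) k - my_at my i (Rep_cell j - 1) k) / mesh TYPE('y))"

definition constraint_set ::
    "('x::finite, 'y::finite) field \<Rightarrow> (('x, 'y, 't::finite) arr \<times> ('x, 'y, 't) mom) set" where
  "constraint_set \<mu>0 = {(\<rho>, mx, my). D_t \<mu>0 \<rho> + D_x mx + D_y my = 0}"


definition metric_at :: "('x::finite, 'y::finite) metric \<Rightarrow> 'x cell \<Rightarrow> 'y cell \<Rightarrow> real ^ 2 ^ 2" where
  "metric_at g i j = (case g of (gxx, gxy, gyy) \<Rightarrow>
     vector [vector [gxx $ i $ j, gxy $ i $ j], vector [gxy $ i $ j, gyy $ i $ j]])"

definition sym_pos_def :: "real ^ 'n ^ 'n \<Rightarrow> bool" where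
  "sym_pos_def A \<longleftrightarrow> transpose A = A \<and> (\<forall>v. v \<noteq> 0 \<longrightarrow> 0 < v \<bullet> (A *v v))"

definition objective :: "real \<Rightarrow> real \<Rightarrow> ('x::finite, 'y::finite) field \<Rightarrow> ('x, 'y) field
    \<Rightarrow> ('x, 'y) param \<Rightarrow> ('x, 'y, 't::finite) arr \<times> ('x, 'y, 't) mom \<Rightarrow> real" where
  "objective \<gamma>I \<gamma>T \<mu>0 \<mu>1 = (\<lambda>(g, b) (\<rho>, m).
     mesh TYPE('x) * mesh TYPE('y) * mesh TYPE('t) *
       (\<Sum>i\<in>UNIV. \<Sum>j\<in>UNIV. \<Sum>k\<in>UNIV.
          (m_bar m i j k \<bullet> (metric_at g i j *v m_bar m i j k)) / (2 * rho_bar \<mu>0 \<rho> $ i $ j $ k)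
          + \<gamma>I * rho_bar \<mu>0 \<rho> $ i $ j $ k * ln (rho_bar \<mu>0 \<rho> $ i $ j $ k))
     + mesh TYPE('x) * mesh TYPE('y) * mesh TYPE('t) *
       (\<Sum>i\<in>UNIV. \<Sum>j\<in>UNIV. \<Sum>k\<in>UNIV. \<rho> $ i $ j $ k * b $ i $ j)
     + \<gamma>T * mesh TYPE('x) * mesh TYPE('y) *
       (\<Sum>i\<in>UNIV. \<Sum>j\<in>UNIV. \<rho> $ i $ j $ last_cell *
          (ln (\<rho> $ i $ j $ last_cell) - ln (\<mu>1 $ i $ j))))"

definition positive_arr :: "('x::finite, 'y::finite, 't::finite) arr \<Rightarrow> bool" where
  "positive_arr \<rho> \<longleftrightarrow> (\<forall>i j k. 0 < \<rho> $ i $ j $ k)"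

definition is_minimizer :: "real \<Rightarrow> real \<Rightarrow> ('x::finite, 'y::finite) field \<Rightarrow> ('x, 'y) field
    \<Rightarrow> ('x, 'y) param \<Rightarrow> ('x, 'y, 't::finite) arr \<times> ('x, 'y, 't) mom \<Rightarrow> bool" where
  "is_minimizer \<gamma>I \<gamma>T \<mu>0 \<mu>1 p =
     is_arg_min (objective \<gamma>I \<gamma>T \<mu>0 \<mu>1 p) (\<lambda>(\<rho>, m). (\<rho>, m) \<in> constraint_set \<mu>0 \<and> positive_arr \<rho>)"


definition It_adj :: "('x::finite, 'y::finite, 't::finite) arr \<Rightarrow> ('x, 'y, 't) arr" where
  "It_adj \<phi> = (\<chi> i j k. if k = last_cell then \<phi> $ i $ j $ k / 2
     else (\<phi> $ i $ j $ k + \<phi> $ i $ j $ succ_cell k) / 2)"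

definition Ix_adj :: "('x::finite, 'y::finite, 't::finite) arr \<Rightarrow> ('x, 'y, 't) arr_x" where
  "Ix_adj \<phi> = (\<chi> i j k. (\<phi> $ lower_cell i $ j $ k + \<phi> $ upper_cell i $ j $ k) / 2)"

definition Iy_adj :: "('x::finite, 'y::finite, 't::finite) arr \<Rightarrow> ('x, 'y, 't) arr_y" where
  "Iy_adj \<phi> = (\<chi> i j k. (\<phi> $ i $ lower_cell j $ k + \<phi> $ i $ upper_cell j $ k) / 2)"

definition Dt_adj :: "('x::finite, 'y::finite, 't::finite) arr \<Rightarrow> ('x, 'y, 't) arr" where
  "Dt_adj \<phi> = (\<chi> i j k. if k = last_cell then \<phi> $ i $ j $ k / mesh TYPE('t)
     else - (\<phi> $ i $ j $ succ_cell k - \<phi> $ i $ j $ k) / mesh TYPE('t))"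

definition Dx_adj :: "('x::finite, 'y::finite, 't::finite) arr \<Rightarrow> ('x, 'y, 't) arr_x" where
  "Dx_adj \<phi> = (\<chi> i j k. - (\<phi> $ upper_cell i $ j $ k - \<phi> $ lower_cell i $ j $ k) / mesh TYPE('x))"

definition Dy_adj :: "('x::finite, 'y::finite, 't::finite) arr \<Rightarrow> ('x, 'y, 't) arr_y" where
  "Dy_adj \<phi> = (\<chi> i j k. - (\<phi> $ i $ upper_cell j $ k - \<phi> $ i $ lower_cell j $ k) / mesh TYPE('y))"


definition Y_rho :: "real \<Rightarrow> real \<Rightarrow> ('x::finite, 'y::finite) field \<Rightarrow> ('x, 'y) field
    \<Rightarrow> ('x, 'y, 't::finite) unknown \<Rightarrow> ('x, 'y) param \<Rightarrow> ('x, 'y, 't) arr" where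
  "Y_rho \<gamma>I \<gamma>T \<mu>0 \<mu>1 = (\<lambda>(\<rho>, m, \<phi>) (g, b).
     - Dt_adj \<phi>
     + It_adj (\<chi> i j k.
         - (m_bar m i j k \<bullet> (metric_at g i j *v m_bar m i j k)) / (2 * (rho_bar \<mu>0 \<rho> $ i $ j $ k)\<^sup>2)
         + \<gamma>I * (ln (rho_bar \<mu>0 \<rho> $ i $ j $ k) + 1))
     + (\<chi> i j k. b $ i $ j
         + (if k = last_cell
            then \<gamma>T / mesh TYPE('t) * (ln (\<rho> $ i $ j $ last_cell) - ln (\<mu>1 $ i $ j) + 1) else 0)))"

definition Y_mx :: "('x::finite, 'y::finite) field
    \<Rightarrow> ('x, 'y, 't::finite) unknown \<Rightarrow> ('x, 'y) param \<Rightarrow> ('x, 'y, 't) arr_x" where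
  "Y_mx \<mu>0 = (\<lambda>(\<rho>, (mx, my), \<phi>) ((gxx, gxy, gyy), b).
     - Dx_adj \<phi>
     + Ix_adj (\<chi> i j k.
         (gxx $ i $ j * mx_bar mx $ i $ j $ k + gxy $ i $ j * my_bar my $ i $ j $ k)
         / rho_bar \<mu>0 \<rho> $ i $ j $ k))"

definition Y_my :: "('x::finite, 'y::finite) field
    \<Rightarrow> ('x, 'y, 't::finite) unknown \<Rightarrow> ('x, 'y) param \<Rightarrow> ('x, 'y, 't) arr_y" where
  "Y_my \<mu>0 = (\<lambda>(\<rho>, (mx, my), \<phi>) ((gxx, gxy, gyy), b).
     - Dy_adj \<phi>
     + Iy_adj (\<chi> i j k.
         (gxy $ i $ j * mx_bar mx $ i $ j $ k + gyy $ i $ j * my_bar my $ i $ j $ k)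
         / rho_bar \<mu>0 \<rho> $ i $ j $ k))"

definition Y_phi :: "('x::finite, 'y::finite) field
    \<Rightarrow> ('x, 'y, 't::finite) unknown \<Rightarrow> ('x, 'y, 't) arr" where
  "Y_phi \<mu>0 = (\<lambda>(\<rho>, (mx, my), \<phi>). D_t \<mu>0 \<rho> + D_x mx + D_y my)"

definition Y_map :: "real \<Rightarrow> real \<Rightarrow> ('x::finite, 'y::finite) field \<Rightarrow> ('x, 'y) field
    \<Rightarrow> ('x, 'y, 't::finite) unknown \<Rightarrow> ('x, 'y) param \<Rightarrow> ('x, 'y, 't) unknown" where
  "Y_map \<gamma>I \<gamma>T \<mu>0 \<mu>1 u p =
     (Y_rho \<gamma>I \<gamma>T \<mu>0 \<mu>1 u p, (Y_mx \<mu>0 u p, Y_my \<mu>0 u p), Y_phi \<mu>0 u)"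

definition solves_forward :: "real \<Rightarrow> real \<Rightarrow> ('x::finite, 'y::finite) field \<Rightarrow> ('x, 'y) field
    \<Rightarrow> ('x, 'y) param \<Rightarrow> ('x, 'y, 't::finite) unknown \<Rightarrow> bool" where
  "solves_forward \<gamma>I \<gamma>T \<mu>0 \<mu>1 p = (\<lambda>(\<rho>, m, \<phi>).
     positive_arr \<rho> \<and> is_minimizer \<gamma>I \<gamma>T \<mu>0 \<mu>1 p (\<rho>, m) \<and> Y_map \<gamma>I \<gamma>T \<mu>0 \<mu>1 (\<rho>, m, \<phi>) p = 0)"

definition C1_map_on :: "'a::real_normed_vector set \<Rightarrow> ('a \<Rightarrow> 'b::real_normed_vector) \<Rightarrow> bool" where
  "C1_map_on S f \<longleftrightarrow> (\<exists>f' :: 'a \<Rightarrow> 'a \<Rightarrow>\<^sub>L 'b.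
     (\<forall>x\<in>S. (f has_derivative blinfun_apply (f' x)) (at x)) \<and> continuous_on S f')"

end

theory Submission
  imports Defs
begin

text \<open>
  The implicit function theorem applies to \<open>Y(u; p) = 0\<close>.  Summation by parts turns the pairing
  of \<open>Y\<close> with a direction \<open>(d\<rho>, dm)\<close> into the first variation of the objective minus the
  pairing of \<open>\<phi>\<close> with the linearized constraint.  Differentiating along a kernel vector of
  \<open>D\<^sub>uY\<close>, the constraint term vanishes and what remains is the Hessian of the objective, a sum of
  terms \<open>(dm - (d\<rho>/\<rho>) m)\<^sup>T g (dm - (d\<rho>/\<rho>) m) / \<rho> + \<gamma>\<^sub>I (d\<rho>)\<^sup>2 / \<rho>\<close> in the interpolated
  variables plus a nonnegative terminal term.  It vanishes only for \<open>d\<rho> = 0\<close>, \<open>dm = 0\<close>, because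
  the initial value of \<open>\<rho>\<close> and the boundary values of \<open>m\<close> make the interpolations injective;
  the multiplier direction then vanishes as the adjoint of the time difference is injective.
  Positivity of \<open>\<rho>\<close> and definiteness of \<open>g\<close> are open conditions, and under them the objective
  is convex, so that zeros of \<open>Y\<close> are minimizers.
\<close>

subsection \<open>Continuously differentiable maps\<close>

text \<open>In finite dimension an operator-valued map is continuous as soon as its values on each
  fixed vector are. Derivatives can therefore be treated as plain functions, one direction
  \<open>h\<close> at a time.\<close>

lemma C1_map_onI:
  fixes f :: "'a::euclidean_space \<Rightarrow> 'b::real_normed_vector"
  assumes "\<And>x. x \<in> S \<Longrightarrow> (f has_derivative f' x) (at x)"
    and "\<And>h. continuous_on S (\<lambda>x. f' x h)"
  shows "C1_map_on S f"
  unfolding C1_map_on_def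
proof (intro exI conjI ballI)
  have eq: "blinfun_apply (Blinfun (f' x)) = f' x" if "x \<in> S" for x
    using assms(1)[OF that] by (simp add: bounded_linear_Blinfun_apply has_derivative_bounded_linear)
  show "(f has_derivative blinfun_apply (Blinfun (f' x))) (at x)" if "x \<in> S" for x
    using assms(1) that by (simp add: eq)
  show "continuous_on S (\<lambda>x. Blinfun (f' x))"
  proof (rule continuous_on_blinfun_componentwise)
    show "continuous_on S (\<lambda>x. Blinfun (f' x) h)" for h
      using assms(2)[of h] by (simp add: eq cong: continuous_on_cong)
  qed
qed

lemma C1_map_onE:
  assumes "C1_map_on S f"
  obtains f' where "\<And>x. x \<in> S \<Longrightarrow> (f has_derivative f' x) (at x)"
    and "\<And>h. continuous_on S (\<lambda>x. f' x h)"
proof -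
  from assms obtain f' where f': "\<forall>x\<in>S. (f has_derivative blinfun_apply (f' x)) (at x)"
    "continuous_on S f'" unfolding C1_map_on_def by blast
  show thesis
    by (rule that[of "\<lambda>x. blinfun_apply (f' x)"]) (use f' in \<open>auto intro!: continuous_intros\<close>)
qed

lemma C1_map_on_continuous_on: "C1_map_on S f \<Longrightarrow> continuous_on S f"
  unfolding C1_map_on_def
  by (meson continuous_at_imp_continuous_on has_derivative_continuous)

lemma C1_map_on_subset: "C1_map_on S f \<Longrightarrow> T \<subseteq> S \<Longrightarrow> C1_map_on T f"
  unfolding C1_map_on_def by (meson continuous_on_subset subsetD)

section \<open>Closure rules for \<open>C1_map_on\<close>\<close>

lemma C1_map_on_const: "C1_map_on S (\<lambda>x::'a::euclidean_space. c)"
  by (rule C1_map_onI[where f' = "\<lambda>_ _. 0"]) auto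

lemma C1_map_on_id: "C1_map_on S (\<lambda>x::'a::euclidean_space. x)"
  by (rule C1_map_onI[where f' = "\<lambda>_ h. h"]) auto

lemma C1_map_on_bounded_linear:
  fixes f :: "'a::euclidean_space \<Rightarrow> 'b::real_normed_vector"
  assumes "bounded_linear F" "C1_map_on S f"
  shows "C1_map_on S (\<lambda>x. F (f x))"
proof -
  from assms(2) obtain f' where "\<And>x. x \<in> S \<Longrightarrow> (f has_derivative f' x) (at x)"
    "\<And>h. continuous_on S (\<lambda>x. f' x h)" by (rule C1_map_onE) blast
  then show ?thesis
    by (intro C1_map_onI[where f' = "\<lambda>x h. F (f' x h)"])
       (auto intro: bounded_linear.has_derivative[OF assms(1)] bounded_linear.continuous_on[OF assms(1)])
qed

lemmas C1_map_on_fst = C1_map_on_bounded_linear[OF bounded_linear_fst]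
lemmas C1_map_on_snd = C1_map_on_bounded_linear[OF bounded_linear_snd]
lemmas C1_map_on_vec_nth = C1_map_on_bounded_linear[OF bounded_linear_vec_nth]
lemmas C1_map_on_minus = C1_map_on_bounded_linear[OF bounded_linear_minus[OF bounded_linear_ident]]
lemmas C1_map_on_divide_const = C1_map_on_bounded_linear[OF bounded_linear_divide]

lemma C1_map_on_add:
  fixes f g :: "'a::euclidean_space \<Rightarrow> 'b::real_normed_vector"
  assumes "C1_map_on S f" "C1_map_on S g"
  shows "C1_map_on S (\<lambda>x. f x + g x)"
proof -
  from assms(1) obtain f' where "\<And>x. x \<in> S \<Longrightarrow> (f has_derivative f' x) (at x)"
    "\<And>h. continuous_on S (\<lambda>x. f' x h)" by (rule C1_map_onE) blast
  moreover from assms(2) obtain g' where "\<And>x. x \<in> S \<Longrightarrow> (g has_derivative g' x) (at x)"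
    "\<And>h. continuous_on S (\<lambda>x. g' x h)" by (rule C1_map_onE) blast
  ultimately show ?thesis
    by (intro C1_map_onI[where f' = "\<lambda>x h. f' x h + g' x h"])
       (auto intro!: has_derivative_add continuous_intros)
qed

lemma C1_map_on_diff:
  fixes f g :: "'a::euclidean_space \<Rightarrow> 'b::real_normed_vector"
  assumes "C1_map_on S f" "C1_map_on S g"
  shows "C1_map_on S (\<lambda>x. f x - g x)"
  using C1_map_on_add[OF assms(1) C1_map_on_minus[OF assms(2)]] by simp

lemma C1_map_on_Pair:
  fixes f :: "'a::euclidean_space \<Rightarrow> 'b::real_normed_vector"
    and g :: "'a \<Rightarrow> 'c::real_normed_vector"
  assumes "C1_map_on S f" "C1_map_on S g"
  shows "C1_map_on S (\<lambda>x. (f x, g x))"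
proof -
  from assms(1) obtain f' where "\<And>x. x \<in> S \<Longrightarrow> (f has_derivative f' x) (at x)"
    "\<And>h. continuous_on S (\<lambda>x. f' x h)" by (rule C1_map_onE) blast
  moreover from assms(2) obtain g' where "\<And>x. x \<in> S \<Longrightarrow> (g has_derivative g' x) (at x)"
    "\<And>h. continuous_on S (\<lambda>x. g' x h)" by (rule C1_map_onE) blast
  ultimately show ?thesis
    by (intro C1_map_onI[where f' = "\<lambda>x h. (f' x h, g' x h)"])
       (auto intro!: has_derivative_Pair continuous_intros)
qed

text \<open>A vector is the finite sum of its components placed by the bounded linear maps
  \<open>axis i\<close>, so the sum rule applies.\<close>

lemma has_derivative_vec_lambda:
  fixes f :: "'n::finite \<Rightarrow> 'a::real_normed_vector \<Rightarrow> 'b::euclidean_space"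
  assumes "\<And>i. (f i has_derivative f' i) F"
  shows "((\<lambda>x. \<chi> i. f i x) has_derivative (\<lambda>h. \<chi> i. f' i h)) F"
proof -
  have lin: "bounded_linear (axis i :: 'b \<Rightarrow> 'b ^ 'n)" for i
    by (intro linear_conv_bounded_linear[THEN iffD1] linearI) (auto simp: axis_def vec_eq_iff)
  have vec: "(\<chi> i. v i) = (\<Sum>i\<in>UNIV. axis i (v i))" for v :: "'n \<Rightarrow> 'b"
    by (simp add: vec_eq_iff axis_def)
  show ?thesis
    unfolding vec by (intro has_derivative_sum bounded_linear.has_derivative[OF lin] assms)
qed

lemma C1_map_on_vec_lambda:
  fixes f :: "'n::finite \<Rightarrow> 'a::euclidean_space \<Rightarrow> 'b::euclidean_space"
  assumes "\<And>i. C1_map_on S (f i)"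
  shows "C1_map_on S (\<lambda>x. \<chi> i. f i x)"
proof -
  have "\<exists>f'. (\<forall>x\<in>S. (f i has_derivative f' x) (at x)) \<and> (\<forall>h. continuous_on S (\<lambda>x. f' x h))" for i
    using assms[of i] by (rule C1_map_onE) blast
  then obtain f' where "\<And>i x. x \<in> S \<Longrightarrow> (f i has_derivative f' i x) (at x)"
    "\<And>i h. continuous_on S (\<lambda>x. f' i x h)" by metis
  then show ?thesis
    by (intro C1_map_onI[where f' = "\<lambda>x h. \<chi> i. f' i x h"])
       (auto intro!: has_derivative_vec_lambda continuous_intros)
qed

lemma C1_map_on_mult:
  fixes f g :: "'a::euclidean_space \<Rightarrow> real"
  assumes "C1_map_on S f" "C1_map_on S g"
  shows "C1_map_on S (\<lambda>x. f x * g x)"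
proof -
  note fc = assms[THEN C1_map_on_continuous_on]
  from assms(1) obtain f' where "\<And>x. x \<in> S \<Longrightarrow> (f has_derivative f' x) (at x)"
    "\<And>h. continuous_on S (\<lambda>x. f' x h)" by (rule C1_map_onE) blast
  moreover from assms(2) obtain g' where "\<And>x. x \<in> S \<Longrightarrow> (g has_derivative g' x) (at x)"
    "\<And>h. continuous_on S (\<lambda>x. g' x h)" by (rule C1_map_onE) blast
  ultimately show ?thesis using fc
    by (intro C1_map_onI[where f' = "\<lambda>x h. f x * g' x h + f' x h * g x"])
       (auto intro!: has_derivative_mult continuous_intros)
qed

lemma C1_map_on_divide:
  fixes f g :: "'a::euclidean_space \<Rightarrow> real"
  assumes "C1_map_on S f" "C1_map_on S g" and nz: "\<And>x. x \<in> S \<Longrightarrow> g x \<noteq> 0"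
  shows "C1_map_on S (\<lambda>x. f x / g x)"
proof -
  note gc = assms(2)[THEN C1_map_on_continuous_on]
  from assms(2) obtain g' where "\<And>x. x \<in> S \<Longrightarrow> (g has_derivative g' x) (at x)"
    "\<And>h. continuous_on S (\<lambda>x. g' x h)" by (rule C1_map_onE) blast
  then have "C1_map_on S (\<lambda>x. inverse (g x))" using gc nz
    by (intro C1_map_onI[where f' = "\<lambda>x h. - (inverse (g x) * g' x h * inverse (g x))"])
       (auto intro!: has_derivative_inverse continuous_intros)
  from C1_map_on_mult[OF assms(1) this] show ?thesis by (simp add: divide_inverse)
qed

lemma C1_map_on_ln:
  fixes f :: "'a::euclidean_space \<Rightarrow> real"
  assumes "C1_map_on S f" and nz: "\<And>x. x \<in> S \<Longrightarrow> 0 < f x"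
  shows "C1_map_on S (\<lambda>x. ln (f x))"
proof -
  note fc = assms(1)[THEN C1_map_on_continuous_on]
  from assms(1) obtain f' where "\<And>x. x \<in> S \<Longrightarrow> (f has_derivative f' x) (at x)"
    "\<And>h. continuous_on S (\<lambda>x. f' x h)" by (rule C1_map_onE) blast
  then show ?thesis using fc nz
    by (intro C1_map_onI[where f' = "\<lambda>x h. f' x h * inverse (f x)"])
       (auto intro!: has_derivative_ln continuous_intros simp: less_imp_neq[symmetric])
qed

lemmas C1_map_on_intros =
  C1_map_on_const C1_map_on_id C1_map_on_fst C1_map_on_snd C1_map_on_vec_nth C1_map_on_minus
  C1_map_on_divide_const C1_map_on_add C1_map_on_diff C1_map_on_mult C1_map_on_Pair
  C1_map_on_vec_lambda

subsection \<open>The implicit function theorem\<close>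

text \<open>If \<open>k\<close> solves the equation at \<open>a\<close> and \<open>k + v\<close>
  solves it at \<open>x\<close>, then \<open>A x v = - (A x - A a) k\<close>. The bound of
  \<open>A a\<close> from below survives small perturbations, so \<open>v\<close> tends to 0 with
  \<open>A x - A a\<close>. Continuity for each fixed \<open>y\<close> is all that
  \<open>C1_map_onI\<close> asks for.\<close>

lemma continuous_on_inv_blinfun:
  fixes A :: "'x::t2_space \<Rightarrow> 'a::euclidean_space \<Rightarrow>\<^sub>L 'a"
  assumes cont: "continuous_on S A" and bij: "\<And>x. x \<in> S \<Longrightarrow> bij (blinfun_apply (A x))"
  shows "continuous_on S (\<lambda>x. inv (blinfun_apply (A x)) y)"
  unfolding continuous_on_def
proof
  fix a assume a: "a \<in> S"
  define k where "k = inv (blinfun_apply (A a)) y"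
  have Ak: "A a k = y" unfolding k_def using bij[OF a] by (meson bij_inv_eq_iff)
  have lim: "(A \<longlongrightarrow> A a) (at a within S)" using cont a by (simp add: continuous_on_def)
  obtain c where c: "c > 0" "\<And>v. norm (A a v) \<ge> c * norm v"
    using linear_inj_bounded_below_pos[of "blinfun_apply (A a)"] bij[OF a]
    by (metis bij_is_inj blinfun.bounded_linear_right bounded_linear.linear mult.commute)
  have bound: "norm (inv (blinfun_apply (A x)) y - k) \<le> norm (A x - A a) * (2 / c * norm k)"
    if x: "x \<in> S" and near: "norm (A x - A a) < c / 2" for x
  proof -
    define v where "v = inv (blinfun_apply (A x)) y - k"
    have "A x (inv (blinfun_apply (A x)) y) = y"
      using bij[OF x] by (meson bij_inv_eq_iff)
    then have Av: "A x v = - (A x - A a) k"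
      by (simp add: v_def blinfun.bilinear_simps Ak)
    \<comment> \<open>The term \<open>(A x - A a) v\<close> costs at most half of the lower bound
      \<open>c * norm v\<close>; this is why nearness is measured by \<open>c / 2\<close>.\<close>
    have "c * norm v \<le> norm (A x v - (A x - A a) v)"
      using c(2)[of v] by (simp add: blinfun.bilinear_simps)
    also have "\<dots> \<le> norm (A x v) + norm ((A x - A a) v)" by (rule norm_triangle_ineq4)
    also have "norm (A x v) \<le> norm (A x - A a) * norm k"
      unfolding Av using norm_blinfun[of "A x - A a" k] by (simp add: blinfun.bilinear_simps norm_minus_commute)
    also have "norm ((A x - A a) v) \<le> c / 2 * norm v"
      using near by (meson less_imp_le mult_right_mono norm_blinfun norm_ge_zero order_trans)
    finally have "c / 2 * norm v \<le> norm (A x - A a) * norm k" by simp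
    then show ?thesis using c(1) by (simp add: v_def field_simps)
  qed
  have near: "\<forall>\<^sub>F x in at a within S. norm (A x - A a) < c / 2"
    using tendstoD[OF lim, of "c / 2"] c(1) by (simp add: dist_norm)
  have "((\<lambda>x. norm (A x - A a) * (2 / c * norm k)) \<longlongrightarrow> 0) (at a within S)"
    using tendsto_mult_left_zero[OF tendsto_norm_zero[OF LIM_zero[OF lim]]] by blast
  then have "((\<lambda>x. inv (blinfun_apply (A x)) y - k) \<longlongrightarrow> 0) (at a within S)"
    by (rule Lim_null_comparison[rotated])
       (use near bound in \<open>auto simp: eventually_at_filter elim!: eventually_mono\<close>)
  then show "((\<lambda>x. inv (blinfun_apply (A x)) y) \<longlongrightarrow> inv (blinfun_apply (A a)) y) (at a within S)"
    unfolding k_def by (rule LIM_zero_cancel)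
qed

text \<open>The inverse function theorem is applied to \<open>F (p, u) = (p, Y (p, u))\<close>, and
  \<open>T p\<close> is the second component of the local inverse at \<open>(p, 0)\<close>. Since
  \<open>u\<close> and \<open>Y\<close> have values in the same finite-dimensional space,
  injectivity of the partial derivative at the base point is enough.\<close>

theorem implicit_function_theorem:
  fixes Y :: "'p::euclidean_space \<times> 'u::euclidean_space \<Rightarrow> 'u"
  assumes "open U" and C1: "C1_map_on U Y" and base: "(p0, u0) \<in> U" and zero: "Y (p0, u0) = 0"
    and inj: "\<And>D k. ((\<lambda>u. Y (p0, u)) has_derivative D) (at u0) \<Longrightarrow> D k = 0 \<Longrightarrow> k = 0"
  obtains ru rl T where "ru > 0" "rl > 0" "ball p0 ru \<times> ball u0 rl \<subseteq> U"
    and "\<And>p. p \<in> ball p0 ru \<Longrightarrow> T p \<in> ball u0 rl" and "\<And>p. p \<in> ball p0 ru \<Longrightarrow> Y (p, T p) = 0"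
    and "\<And>p u. p \<in> ball p0 ru \<Longrightarrow> u \<in> ball u0 rl \<Longrightarrow> Y (p, u) = 0 \<Longrightarrow> u = T p"
    and "T p0 = u0" and "C1_map_on (ball p0 ru) T"
    and "\<And>p. p \<in> ball p0 ru \<Longrightarrow> \<exists>DuY DpY. ((\<lambda>u. Y (p, u)) has_derivative DuY) (at (T p)) \<and>
           ((\<lambda>q. Y (q, T p)) has_derivative DpY) (at p) \<and> bij DuY \<and>
           (T has_derivative (\<lambda>h. - inv DuY (DpY h))) (at p)"
proof -
  define F where "F = (\<lambda>x. (fst x, Y x))"
  have "C1_map_on U F" unfolding F_def by (intro C1_map_on_intros C1)
  then obtain F' where F': "\<And>x. x \<in> U \<Longrightarrow> (F has_derivative blinfun_apply (F' x)) (at x)"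
    and F'cont: "continuous_on U F'" unfolding C1_map_on_def by blast
  define Y' where "Y' = (\<lambda>x h. snd (blinfun_apply (F' x) h))"
  have Y': "(Y has_derivative Y' x) (at x)" if "x \<in> U" for x
    using has_derivative_snd[OF F'[OF that]] by (simp add: F_def Y'_def)
  \<comment> \<open>\<open>F\<close> keeps its first argument, so its derivative has block
    triangular form and a kernel vector is \<open>(0, k)\<close> with \<open>k\<close> in the kernel
    of the partial derivative in \<open>u\<close>.\<close>
  have F'_eq: "blinfun_apply (F' x) h = (fst h, Y' x h)" if "x \<in> U" for x h
  proof -
    have "((\<lambda>x. fst (F x)) has_derivative (\<lambda>h. fst (blinfun_apply (F' x) h))) (at x)"
      by (intro has_derivative_fst F' that)
    moreover have "((\<lambda>x. fst (F x)) has_derivative fst) (at x)"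
      unfolding F_def by (auto intro!: derivative_eq_intros)
    ultimately have "(\<lambda>h. fst (blinfun_apply (F' x) h)) = fst" by (rule has_derivative_unique)
    then show ?thesis unfolding Y'_def by (metis prod.collapse)
  qed
  have Yu: "((\<lambda>u. Y (p, u)) has_derivative (\<lambda>k. Y' (p, u) (0, k))) (at u)" if "(p, u) \<in> U" for p u
    by (rule has_derivative_compose[OF has_derivative_Pair[OF has_derivative_const has_derivative_ident] Y'[OF that]])
  have Yp: "((\<lambda>p. Y (p, u)) has_derivative (\<lambda>h. Y' (p, u) (h, 0))) (at p)" if "(p, u) \<in> U" for p u
    by (rule has_derivative_compose[OF has_derivative_Pair[OF has_derivative_ident has_derivative_const] Y'[OF that]])
  have lin0: "linear (blinfun_apply (F' (p0, u0)))"
    by (simp add: blinfun.bounded_linear_right bounded_linear.linear)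
  have "inj (blinfun_apply (F' (p0, u0)))"
    unfolding linear_injective_0[OF lin0]
  proof (intro allI impI)
    fix h assume "blinfun_apply (F' (p0, u0)) h = 0"
    then have "fst h = 0" "Y' (p0, u0) (0, snd h) = 0"
      using F'_eq[OF base, of h] by (auto simp: zero_prod_def) (metis prod.collapse)
    with inj[OF Yu[OF base]] show "h = 0" by (metis prod.collapse zero_prod_def)
  qed
  then obtain G where G: "linear G" "\<And>x. G (blinfun_apply (F' (p0, u0)) x) = x"
    using linear_injective_left_inverse[OF lin0] by (metis comp_apply id_apply)
  have inv0: "Blinfun G o\<^sub>L F' (p0, u0) = id_blinfun"
    using G by (intro blinfun_eqI)
      (simp add: bounded_linear_Blinfun_apply linear_conv_bounded_linear[THEN iffD1])
  \<comment> \<open>From here on \<open>G\<close> is the local inverse of \<open>F\<close> and no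
    longer the linear left inverse used for the hypothesis of the inverse function theorem.\<close>
  obtain U' V G G' where "open U'" and U'U: "U' \<subseteq> U" and base': "(p0, u0) \<in> U'" and "open V"
    and baseV: "F (p0, u0) \<in> V" and hom: "homeomorphism U' V F G"
    and Gd: "\<And>y. y \<in> V \<Longrightarrow> (G has_derivative G' y) (at y)"
    and G': "\<And>y. y \<in> V \<Longrightarrow> G' y = inv (blinfun_apply (F' (G y)))"
    and bij: "\<And>y. y \<in> V \<Longrightarrow> bij (blinfun_apply (F' (G y)))"
    using inverse_function_theorem[OF \<open>open U\<close> F' F'cont base inv0] by metis
  define T where "T = (\<lambda>p. snd (G (p, 0)))"
  have GU: "G y \<in> U'" and FG: "F (G y) = y" if "y \<in> V" for y
    using hom that by (auto simp: homeomorphism_def)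
  have GF: "G (F x) = x" if "x \<in> U'" for x using hom that by (auto simp: homeomorphism_def)
  have GT: "G (p, 0) = (p, T p)" if "(p, 0) \<in> V" for p
    using FG[OF that] unfolding F_def T_def by (metis fst_conv prod.collapse)
  have V0: "(p0, 0) \<in> V" using baseV zero by (simp add: F_def)
  have T0: "T p0 = u0" using GF[OF base'] zero by (simp add: F_def T_def)
  define V0 where "V0 = {p. (p, 0::'u) \<in> V}"
  have "open V0" unfolding V0_def
    using open_vimage[OF \<open>open V\<close>, of "\<lambda>p. (p, 0::'u)"]
    by (simp add: vimage_def continuous_on_Pair)
  have Td: "(T has_derivative (\<lambda>h. snd (G' (p, 0) (h, 0)))) (at p)" if "p \<in> V0" for p
  proof -
    have "(p, 0) \<in> V" using that by (simp add: V0_def)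
    then have "((\<lambda>p. G (p, 0)) has_derivative (\<lambda>h. G' (p, 0) (h, 0))) (at p)"
      using has_derivative_compose[OF has_derivative_Pair[OF has_derivative_ident has_derivative_const] Gd]
      by blast
    then show ?thesis unfolding T_def by (rule has_derivative_snd)
  qed
  have Tcont: "isCont T p" if "p \<in> V0" for p
    using Td[OF that] by (rule has_derivative_continuous)
  have C1T: "C1_map_on V0 T"
  proof (rule C1_map_onI[OF Td])
    fix h :: 'p
    have Gcont: "continuous_on V0 (\<lambda>p. G (p, 0))"
      by (rule continuous_on_compose2[of V G]) (use hom in \<open>auto simp: homeomorphism_def V0_def intro!: continuous_intros\<close>)
    have "continuous_on V0 (\<lambda>p. F' (G (p, 0)))"
      by (rule continuous_on_compose2[OF F'cont Gcont]) (use GU U'U in \<open>auto simp: V0_def\<close>)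
    then have "continuous_on V0 (\<lambda>p. snd (inv (blinfun_apply (F' (G (p, 0)))) (h, 0)))"
      by (intro continuous_on_snd continuous_on_inv_blinfun) (auto simp: V0_def intro: bij)
    then show "continuous_on V0 (\<lambda>p. snd (G' (p, 0) (h, 0)))"
      by (rule continuous_on_eq) (simp add: G' V0_def)
  qed
  \<comment> \<open>Uniqueness comes from injectivity of \<open>F\<close> on \<open>U'\<close>, so
    both balls must fit into a product inside \<open>U'\<close>: \<open>rl\<close> is chosen first,
    then \<open>ru\<close> so small that \<open>T\<close> maps into the ball of radius
    \<open>rl\<close>.\<close>
  obtain A B where AB: "open A" "open B" "(p0, u0) \<in> A \<times> B" "A \<times> B \<subseteq> U'"
    using open_prod_elim[OF \<open>open U'\<close> base'] by metis
  obtain rl where rl: "rl > 0" "ball u0 rl \<subseteq> B"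
    using AB open_contains_ball by (metis mem_Sigma_iff)
  have "open (A \<inter> V0 \<inter> (V0 \<inter> T -` ball u0 rl))"
    by (intro open_Int AB \<open>open V0\<close> continuous_open_preimage continuous_at_imp_continuous_on)
       (auto intro: Tcont)
  moreover have "p0 \<in> A \<inter> V0 \<inter> (V0 \<inter> T -` ball u0 rl)"
    using AB V0 rl T0 by (auto simp: V0_def)
  ultimately obtain ru where ru: "ru > 0" "ball p0 ru \<subseteq> A \<inter> V0 \<inter> (V0 \<inter> T -` ball u0 rl)"
    using open_contains_ball by metis
  show thesis
  proof (rule that[of ru rl T])
    show sub: "ball p0 ru \<times> ball u0 rl \<subseteq> U" using ru rl AB U'U by fast
    show "C1_map_on (ball p0 ru) T" by (rule C1_map_on_subset[OF C1T]) (use ru in auto)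
    fix p assume p: "p \<in> ball p0 ru"
    then have pV: "p \<in> V0" and pV': "(p, 0) \<in> V" using ru by (auto simp: V0_def)
    show Tp: "T p \<in> ball u0 rl" using p ru by auto
    show Y0: "Y (p, T p) = 0" using FG[OF pV'] GT[OF pV'] by (simp add: F_def)
    show "u = T p" if "u \<in> ball u0 rl" "Y (p, u) = 0" for u
    proof -
      have "(p, u) \<in> U'" using p that ru rl AB by fast
      from GF[OF this] show ?thesis using that by (simp add: F_def T_def)
    qed
    have pU: "(p, T p) \<in> U" using sub p Tp by auto
    define Du where "Du = (\<lambda>k. Y' (p, T p) (0, k))"
    have bijF: "bij (blinfun_apply (F' (p, T p)))" using bij[OF pV'] GT[OF pV'] by simp
    have linu: "linear Du" using Yu[OF pU] by (simp add: Du_def has_derivative_linear)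
    \<comment> \<open>Away from the base point, invertibility of the partial derivative is recovered
      from that of the full derivative of \<open>F\<close>.\<close>
    have "inj Du" unfolding linear_injective_0[OF linu]
    proof (intro allI impI)
      fix k assume "Du k = 0"
      with linear_0[OF linu] have "blinfun_apply (F' (p, T p)) (0, k) = blinfun_apply (F' (p, T p)) 0"
        by (simp add: F'_eq[OF pU] Du_def zero_prod_def)
      then show "k = 0" using bijF by (metis bij_is_inj injD snd_conv zero_prod_def)
    qed
    then have bijD: "bij Du" using linear_inj_imp_surj[OF linu] by (simp add: bij_def)
    \<comment> \<open>The vector \<open>w\<close> has first component \<open>h\<close> and is
      annihilated by \<open>Y'\<close>. Splitting it as \<open>(h, 0) + (0, snd w)\<close> gives a
      linear equation for \<open>snd w\<close>, the derivative of \<open>T\<close> in direction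
      \<open>h\<close>.\<close>
    have eq: "snd (G' (p, 0) (h, 0)) = - inv Du (Y' (p, T p) (h, 0))" for h
    proof -
      define w where "w = G' (p, 0) (h, 0)"
      have "blinfun_apply (F' (p, T p)) w = (h, 0)"
        unfolding w_def G'[OF pV'] GT[OF pV'] using bijF by (meson bij_inv_eq_iff)
      then have w: "fst w = h" "Y' (p, T p) w = 0" by (auto simp: F'_eq[OF pU])
      have lin: "linear (Y' (p, T p))" using Y'[OF pU] by (rule has_derivative_linear)
      have "(h, 0) + (0, snd w) = w" using w(1) by (simp add: prod_eq_iff)
      then have "Y' (p, T p) (h, 0) + Du (snd w) = 0"
        using linear_add[OF lin, of "(h, 0)" "(0, snd w)"] w(2) by (simp only: Du_def)
      then have "Du (- snd w) = Y' (p, T p) (h, 0)"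
        by (simp add: linear_neg[OF linu] neg_eq_iff_add_eq_0 add.commute)
      then show ?thesis unfolding w_def[symmetric] using bijD by (metis bij_inv_eq_iff minus_minus)
    qed
    show "\<exists>DuY DpY. ((\<lambda>u. Y (p, u)) has_derivative DuY) (at (T p)) \<and>
           ((\<lambda>q. Y (q, T p)) has_derivative DpY) (at p) \<and> bij DuY \<and>
           (T has_derivative (\<lambda>h. - inv DuY (DpY h))) (at p)"
      using Yu[OF pU] Yp[OF pU] bijD Td[OF pV] unfolding eq Du_def by blast
  qed (use ru rl T0 in auto)
qed

subsection \<open>Summation by parts on the staggered grid\<close>

lemma Rep_cell_bounds: "1 \<le> Rep_cell k" "Rep_cell (k :: 'n::finite cell) \<le> CARD('n)"
  using Rep_cell[of k] by auto

lemma Rep_Abs_cell: "1 \<le> n \<Longrightarrow> n \<le> CARD('n) \<Longrightarrow> Rep_cell (Abs_cell n :: 'n::finite cell) = n"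
  by (simp add: Abs_cell_inverse)

lemma Rep_face_bounds: "2 \<le> CARD('n) \<Longrightarrow> 1 \<le> Rep_face (i :: 'n::finite face)"
  "2 \<le> CARD('n) \<Longrightarrow> Suc (Rep_face (i :: 'n::finite face)) \<le> CARD('n)"
  using Rep_face[of i] by auto

lemma Rep_Abs_face:
  "1 \<le> n \<Longrightarrow> Suc n \<le> CARD('n) \<Longrightarrow> Rep_face (Abs_face n :: 'n::finite face) = n"
  by (rule Abs_face_inverse) auto

lemma Rep_last_cell: "Rep_cell (last_cell :: 'n::finite cell) = CARD('n)"
  by (simp add: last_cell_def Rep_Abs_cell Suc_le_eq)

lemma not_last_cell: "k \<noteq> last_cell \<longleftrightarrow> Suc (Rep_cell (k :: 'n::finite cell)) \<le> CARD('n)"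
  using Rep_cell_bounds(2)[of k] Rep_cell_inject[of k last_cell]
  by (auto simp: Rep_last_cell Suc_le_eq)

lemma Rep_succ_cell: "k \<noteq> last_cell \<Longrightarrow> Rep_cell (succ_cell k) = Suc (Rep_cell k)"
  by (simp add: succ_cell_def not_last_cell Rep_Abs_cell)

lemma Abs_cell_Rep [simp]: "Abs_cell (Rep_cell k) = k"
  by (rule Rep_cell_inverse)

text \<open>An index shift, with the successor map as bijection from the cells before the last onto
  the cells after the first. The guards exclude the last cell on the left and the first on the
  right, where \<open>succ_cell\<close> and the predecessor index leave the range of
  \<open>Abs_cell\<close>.\<close>

lemma sum_succ_cell:
  fixes w d :: "'n::finite cell \<Rightarrow> 'a::real_inner"
  shows "(\<Sum>k\<in>UNIV. if k = last_cell then 0 else w (succ_cell k) \<bullet> d k)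
    = (\<Sum>k\<in>UNIV. w k \<bullet> (if Rep_cell k = 1 then 0 else d (Abs_cell (Rep_cell k - 1))))"
proof -
  have "(\<Sum>k\<in>UNIV. if k = last_cell then 0 else w (succ_cell k) \<bullet> d k)
    = (\<Sum>k\<in>{k. k \<noteq> last_cell}. w (succ_cell k) \<bullet> d k)"
    by (rule sum.mono_neutral_cong_right) auto
  also have "\<dots> = (\<Sum>k\<in>{k. Rep_cell k \<noteq> 1}. w k \<bullet> d (Abs_cell (Rep_cell k - 1)))"
  proof (rule sum.reindex_bij_witness[where i = "\<lambda>k. Abs_cell (Rep_cell k - 1)" and j = succ_cell])
    fix k :: "'n cell" assume "k \<in> {k. Rep_cell k \<noteq> 1}"
    then have k: "1 \<le> Rep_cell k - 1" "Suc (Rep_cell k - 1) = Rep_cell k"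
      using Rep_cell_bounds(1)[of k] by auto
    then have R: "Rep_cell (Abs_cell (Rep_cell k - 1) :: 'n cell) = Rep_cell k - 1"
      using Rep_cell_bounds(2)[of k] by (simp add: Rep_Abs_cell)
    show "Abs_cell (Rep_cell k - 1) \<in> {k :: 'n cell. k \<noteq> last_cell}"
      using k Rep_cell_bounds(2)[of k] by (simp add: not_last_cell R del: One_nat_def)
    show "succ_cell (Abs_cell (Rep_cell k - 1)) = k"
      unfolding succ_cell_def R k by simp
  qed (use Rep_cell_bounds in \<open>auto simp: Rep_succ_cell Suc_le_eq\<close>)
  also have "\<dots> = (\<Sum>k\<in>UNIV. w k \<bullet> (if Rep_cell k = 1 then 0 else d (Abs_cell (Rep_cell k - 1))))"
    by (rule sum.mono_neutral_cong_left) auto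
  finally show ?thesis .
qed

text \<open>\<open>lower_cell\<close> is a bijection from the interfaces onto the cells other than
  the last; with a single cell, \<open>face\<close> would contain only its dummy element. Values in
  an inner product space allow whole slices of arrays to be paired at once.\<close>

lemma sum_lower_cell:
  fixes w :: "'n::finite cell \<Rightarrow> 'a::real_inner"
  assumes "2 \<le> CARD('n)"
  shows "(\<Sum>i\<in>UNIV. w (lower_cell i) \<bullet> d i)
    = (\<Sum>i\<in>UNIV. w i \<bullet> (if Rep_cell i = CARD('n) then 0 else d (Abs_face (Rep_cell i))))"
proof -
  note bounds = Rep_face_bounds[OF assms]
  have R: "Rep_cell (lower_cell i) = Rep_face i" for i :: "'n face"
    using bounds[of i] by (simp add: lower_cell_def Rep_Abs_cell)
  have "(\<Sum>i\<in>UNIV. w (lower_cell i) \<bullet> d i)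
    = (\<Sum>i\<in>{i. Rep_cell i \<noteq> CARD('n)}. w i \<bullet> d (Abs_face (Rep_cell i)))"
  proof (rule sum.reindex_bij_witness[where i = "\<lambda>i. Abs_face (Rep_cell i)" and j = lower_cell])
    fix i :: "'n cell" assume "i \<in> {i. Rep_cell i \<noteq> CARD('n)}"
    then have "Rep_face (Abs_face (Rep_cell i) :: 'n face) = Rep_cell i"
      using Rep_cell_bounds[of i] by (simp add: Rep_Abs_face Suc_le_eq)
    then show "lower_cell (Abs_face (Rep_cell i)) = i" by (simp add: lower_cell_def)
  next
    fix i :: "'n face"
    show "lower_cell i \<in> {i. Rep_cell i \<noteq> CARD('n)}" using bounds[of i] by (simp add: R)
  qed (auto simp: R Rep_face_inverse)
  also have "\<dots> = (\<Sum>i\<in>UNIV. w i \<bullet> (if Rep_cell i = CARD('n) then 0 else d (Abs_face (Rep_cell i))))"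
    by (rule sum.mono_neutral_cong_left) auto
  finally show ?thesis .
qed

lemma sum_upper_cell:
  fixes w :: "'n::finite cell \<Rightarrow> 'a::real_inner"
  assumes "2 \<le> CARD('n)"
  shows "(\<Sum>i\<in>UNIV. w (upper_cell i) \<bullet> d i)
    = (\<Sum>i\<in>UNIV. w i \<bullet> (if Rep_cell i = 1 then 0 else d (Abs_face (Rep_cell i - 1))))"
proof -
  note bounds = Rep_face_bounds[OF assms]
  have R: "Rep_cell (upper_cell i) = Suc (Rep_face i)" for i :: "'n face"
    using bounds[of i] by (simp add: upper_cell_def Rep_Abs_cell)
  have "(\<Sum>i\<in>UNIV. w (upper_cell i) \<bullet> d i)
    = (\<Sum>i\<in>{i. Rep_cell i \<noteq> 1}. w i \<bullet> d (Abs_face (Rep_cell i - 1)))"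
  proof (rule sum.reindex_bij_witness[where i = "\<lambda>i. Abs_face (Rep_cell i - 1)" and j = upper_cell])
    fix i :: "'n cell" assume "i \<in> {i. Rep_cell i \<noteq> 1}"
    then have "1 \<le> Rep_cell i - 1" "Suc (Rep_cell i - 1) = Rep_cell i"
      using Rep_cell_bounds(1)[of i] by auto
    moreover from this have "Rep_face (Abs_face (Rep_cell i - 1) :: 'n face) = Rep_cell i - 1"
      using Rep_cell_bounds(2)[of i] by (simp add: Rep_Abs_face)
    ultimately show "upper_cell (Abs_face (Rep_cell i - 1)) = i" by (simp add: upper_cell_def)
  next
    fix i :: "'n face"
    show "upper_cell i \<in> {i. Rep_cell i \<noteq> 1}" using bounds(1)[of i] by (simp add: R)
  qed (auto simp: R Rep_face_inverse)
  also have "\<dots> = (\<Sum>i\<in>UNIV. w i \<bullet> (if Rep_cell i = 1 then 0 else d (Abs_face (Rep_cell i - 1))))"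
    by (rule sum.mono_neutral_cong_left) auto
  finally show ?thesis .
qed

lemma Rep_cell_minus_1:
  "(Rep_cell (k :: 'n::finite cell) \<le> 1) = (Rep_cell k = 1)" "(Rep_cell k - 1 = 0) = (Rep_cell k = 1)" "Rep_cell k - 1 \<noteq> CARD('n)"
  "Rep_cell k \<noteq> 0"
  using Rep_cell_bounds[of k] by auto

text \<open>The operator on the right is the interpolation with initial value 0, the linear part of
  the affine map \<open>rho_bar \<mu>0\<close>.\<close>

lemma It_adj_inner:
  fixes w d :: "('x::finite, 'y::finite, 't::finite) arr"
  shows "It_adj w \<bullet> d = w \<bullet> rho_bar 0 d"
proof -
  have "(\<Sum>k\<in>UNIV. It_adj w $ i $ j $ k \<bullet> d $ i $ j $ k)
    = (\<Sum>k\<in>UNIV. w $ i $ j $ k \<bullet> rho_bar 0 d $ i $ j $ k)" for i j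
  proof -
    have "(\<Sum>k\<in>UNIV. It_adj w $ i $ j $ k \<bullet> d $ i $ j $ k)
      = (\<Sum>k\<in>UNIV. w $ i $ j $ k \<bullet> d $ i $ j $ k) / 2
        + (\<Sum>k\<in>UNIV. if k = last_cell then 0 else w $ i $ j $ succ_cell k \<bullet> d $ i $ j $ k) / 2"
      unfolding sum_divide_distrib sum.distrib[symmetric]
      by (rule sum.cong) (auto simp: It_adj_def field_simps)
    then show ?thesis
      unfolding sum_succ_cell[of "\<lambda>k. w $ i $ j $ k" "\<lambda>k. d $ i $ j $ k"] sum_divide_distrib sum.distrib[symmetric]
      by (rule trans) (rule sum.cong, simp_all add: rho_bar_def rho_at_def Rep_cell_minus_1
          algebra_simps add_divide_distrib del: One_nat_def)
  qed
  then show ?thesis by (simp only: inner_vec_def)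
qed

lemma Dt_adj_inner:
  fixes w d :: "('x::finite, 'y::finite, 't::finite) arr"
  shows "Dt_adj w \<bullet> d = w \<bullet> D_t 0 d"
proof -
  have "(\<Sum>k\<in>UNIV. Dt_adj w $ i $ j $ k \<bullet> d $ i $ j $ k)
    = (\<Sum>k\<in>UNIV. w $ i $ j $ k \<bullet> D_t 0 d $ i $ j $ k)" for i j
  proof -
    have "(\<Sum>k\<in>UNIV. Dt_adj w $ i $ j $ k \<bullet> d $ i $ j $ k)
      = (\<Sum>k\<in>UNIV. w $ i $ j $ k \<bullet> d $ i $ j $ k) / mesh TYPE('t)
        - (\<Sum>k\<in>UNIV. if k = last_cell then 0 else w $ i $ j $ succ_cell k \<bullet> d $ i $ j $ k)
          / mesh TYPE('t)"
      unfolding sum_divide_distrib sum_subtractf[symmetric]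
      by (rule sum.cong) (auto simp: Dt_adj_def field_simps diff_divide_distrib)
    then show ?thesis
      unfolding sum_succ_cell[of "\<lambda>k. w $ i $ j $ k" "\<lambda>k. d $ i $ j $ k"] sum_divide_distrib sum_subtractf[symmetric]
      by (rule trans) (rule sum.cong, simp_all add: D_t_def rho_at_def Rep_cell_minus_1
          algebra_simps diff_divide_distrib del: One_nat_def)
  qed
  then show ?thesis by (simp only: inner_vec_def)
qed

text \<open>Slice form of the interpolation, with the boundary tests in the shape produced by
  \<open>sum_lower_cell\<close> and \<open>sum_upper_cell\<close>.\<close>

lemma mx_bar_nth:
  "mx_bar (d :: ('x::finite, 'y::finite, 't::finite) arr_x) $ i
    = (1/2) *\<^sub>R ((if Rep_cell i = 1 then 0 else d $ Abs_face (Rep_cell i - 1))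
        + (if Rep_cell i = CARD('x) then 0 else d $ Abs_face (Rep_cell i)))"
  by (simp add: vec_eq_iff mx_bar_def mx_at_def Rep_cell_minus_1 del: One_nat_def)

lemma my_bar_nth:
  "my_bar (d :: ('x::finite, 'y::finite, 't::finite) arr_y) $ i $ j
    = (1/2) *\<^sub>R ((if Rep_cell j = 1 then 0 else d $ i $ Abs_face (Rep_cell j - 1))
        + (if Rep_cell j = CARD('y) then 0 else d $ i $ Abs_face (Rep_cell j)))"
  by (simp add: vec_eq_iff my_bar_def my_at_def Rep_cell_minus_1 del: One_nat_def)

lemma D_x_nth:
  "D_x (d :: ('x::finite, 'y::finite, 't::finite) arr_x) $ i
    = (1 / mesh TYPE('x)) *\<^sub>R ((if Rep_cell i = CARD('x) then 0 else d $ Abs_face (Rep_cell i))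
        - (if Rep_cell i = 1 then 0 else d $ Abs_face (Rep_cell i - 1)))"
  by (simp add: vec_eq_iff D_x_def mx_at_def Rep_cell_minus_1 del: One_nat_def)

lemma D_y_nth:
  "D_y (d :: ('x::finite, 'y::finite, 't::finite) arr_y) $ i $ j
    = (1 / mesh TYPE('y)) *\<^sub>R ((if Rep_cell j = CARD('y) then 0 else d $ i $ Abs_face (Rep_cell j))
        - (if Rep_cell j = 1 then 0 else d $ i $ Abs_face (Rep_cell j - 1)))"
  by (simp add: vec_eq_iff D_y_def my_at_def Rep_cell_minus_1 del: One_nat_def)

lemma Ix_adj_inner:
  fixes w :: "('x::finite, 'y::finite, 't::finite) arr"
  assumes "2 \<le> CARD('x)"
  shows "Ix_adj w \<bullet> d = w \<bullet> mx_bar d"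
proof -
  have I: "Ix_adj w $ i = (1 / 2) *\<^sub>R (w $ lower_cell i + w $ upper_cell i)" for i
    by (simp add: vec_eq_iff Ix_adj_def)
  have "Ix_adj w \<bullet> d = (\<Sum>i\<in>UNIV. w $ lower_cell i \<bullet> d $ i) / 2
      + (\<Sum>i\<in>UNIV. w $ upper_cell i \<bullet> d $ i) / 2"
    unfolding inner_vec_def[of "Ix_adj w"] sum_divide_distrib sum.distrib[symmetric]
    by (rule sum.cong) (simp_all add: I inner_left_distrib add_divide_distrib)
  then show ?thesis
    unfolding sum_upper_cell[OF assms, of "\<lambda>i. w $ i" "\<lambda>i. d $ i"]
      sum_lower_cell[OF assms, of "\<lambda>i. w $ i" "\<lambda>i. d $ i"]
      inner_vec_def[of "w"] sum_divide_distrib sum.distrib[symmetric]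
    by (simp add: mx_bar_nth inner_right_distrib add_divide_distrib add.commute del: One_nat_def)
qed

lemma Dx_adj_inner:
  fixes w :: "('x::finite, 'y::finite, 't::finite) arr"
  assumes "2 \<le> CARD('x)"
  shows "Dx_adj w \<bullet> d = w \<bullet> D_x d"
proof -
  have I: "Dx_adj w $ i = (1 / mesh TYPE('x)) *\<^sub>R (w $ lower_cell i - w $ upper_cell i)" for i
    by (simp add: vec_eq_iff Dx_adj_def)
  have "Dx_adj w \<bullet> d = (\<Sum>i\<in>UNIV. w $ lower_cell i \<bullet> d $ i) / mesh TYPE('x)
      - (\<Sum>i\<in>UNIV. w $ upper_cell i \<bullet> d $ i) / mesh TYPE('x)"
    unfolding inner_vec_def[of "Dx_adj w"] sum_divide_distrib sum_subtractf[symmetric]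
    by (rule sum.cong) (simp_all add: I inner_diff_left diff_divide_distrib)
  then show ?thesis
    unfolding sum_upper_cell[OF assms, of "\<lambda>i. w $ i" "\<lambda>i. d $ i"]
      sum_lower_cell[OF assms, of "\<lambda>i. w $ i" "\<lambda>i. d $ i"]
      inner_vec_def[of "w"] sum_divide_distrib sum_subtractf[symmetric]
    by (simp add: D_x_nth inner_diff_right diff_divide_distrib add.commute del: One_nat_def)
qed

lemma Iy_adj_inner:
  fixes w :: "('x::finite, 'y::finite, 't::finite) arr"
  assumes "2 \<le> CARD('y)"
  shows "Iy_adj w \<bullet> d = w \<bullet> my_bar d"
proof -
  have I: "Iy_adj w $ i $ j = (1 / 2) *\<^sub>R (w $ i $ lower_cell j + w $ i $ upper_cell j)" for i j
    by (simp add: vec_eq_iff Iy_adj_def)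
  have "Iy_adj w $ i \<bullet> d $ i = w $ i \<bullet> my_bar d $ i" for i
  proof -
    have "Iy_adj w $ i \<bullet> d $ i = (\<Sum>j\<in>UNIV. w $ i $ lower_cell j \<bullet> d $ i $ j) / 2
        + (\<Sum>j\<in>UNIV. w $ i $ upper_cell j \<bullet> d $ i $ j) / 2"
      unfolding inner_vec_def[of "Iy_adj w $ i"] sum_divide_distrib sum.distrib[symmetric]
      by (rule sum.cong) (simp_all add: I inner_left_distrib add_divide_distrib)
    then show ?thesis
      unfolding sum_upper_cell[OF assms, of "\<lambda>j. w $ i $ j" "\<lambda>j. d $ i $ j"]
        sum_lower_cell[OF assms, of "\<lambda>j. w $ i $ j" "\<lambda>j. d $ i $ j"]
        inner_vec_def[of "w $ i"] sum_divide_distrib sum.distrib[symmetric]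
      by (simp add: my_bar_nth inner_right_distrib add_divide_distrib add.commute del: One_nat_def)
  qed
  then show ?thesis by (simp add: inner_vec_def[of "Iy_adj w"] inner_vec_def[of w])
qed

lemma Dy_adj_inner:
  fixes w :: "('x::finite, 'y::finite, 't::finite) arr"
  assumes "2 \<le> CARD('y)"
  shows "Dy_adj w \<bullet> d = w \<bullet> D_y d"
proof -
  have I: "Dy_adj w $ i $ j = (1 / mesh TYPE('y)) *\<^sub>R (w $ i $ lower_cell j - w $ i $ upper_cell j)" for i j
    by (simp add: vec_eq_iff Dy_adj_def)
  have "Dy_adj w $ i \<bullet> d $ i = w $ i \<bullet> D_y d $ i" for i
  proof -
    have "Dy_adj w $ i \<bullet> d $ i = (\<Sum>j\<in>UNIV. w $ i $ lower_cell j \<bullet> d $ i $ j) / mesh TYPE('y)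
        - (\<Sum>j\<in>UNIV. w $ i $ upper_cell j \<bullet> d $ i $ j) / mesh TYPE('y)"
      unfolding inner_vec_def[of "Dy_adj w $ i"] sum_divide_distrib sum_subtractf[symmetric]
      by (rule sum.cong) (simp_all add: I inner_diff_left diff_divide_distrib)
    then show ?thesis
      unfolding sum_upper_cell[OF assms, of "\<lambda>j. w $ i $ j" "\<lambda>j. d $ i $ j"]
        sum_lower_cell[OF assms, of "\<lambda>j. w $ i $ j" "\<lambda>j. d $ i $ j"]
        inner_vec_def[of "w $ i"] sum_divide_distrib sum_subtractf[symmetric]
      by (simp add: D_y_nth inner_diff_right diff_divide_distrib add.commute del: One_nat_def)
  qed
  then show ?thesis by (simp add: inner_vec_def[of "Dy_adj w"] inner_vec_def[of w])
qed

subsection \<open>The density and its variations\<close>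

text \<open>The quadratic form of the symmetric matrix with rows \<open>(a, c)\<close> and
  \<open>(c, d)\<close>.\<close>

definition quad :: "real \<Rightarrow> real \<Rightarrow> real \<Rightarrow> real \<Rightarrow> real \<Rightarrow> real" where
  "quad a c d x y = a * x\<^sup>2 + 2 * c * x * y + d * y\<^sup>2"

definition cell_density :: "real \<Rightarrow> real \<Rightarrow> real \<Rightarrow> real \<Rightarrow> real \<Rightarrow> real \<Rightarrow> real \<Rightarrow> real" where
  "cell_density \<gamma> a c d r x y = quad a c d x y / (2 * r) + \<gamma> * r * ln r"

text \<open>For positive \<open>r\<close>, the differential of \<open>cell_density\<close> at
  \<open>(r, x, y)\<close> in the direction \<open>(r', x', y')\<close>.\<close>

definition variation ::
    "real \<Rightarrow> real \<Rightarrow> real \<Rightarrow> real \<Rightarrow> real \<Rightarrow> real \<Rightarrow> real \<Rightarrow> real \<Rightarrow> real \<Rightarrow> real \<Rightarrow> real" where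
  "variation \<gamma> a c d r x y r' x' y' = (- quad a c d x y / (2 * r\<^sup>2) + \<gamma> * (ln r + 1)) * r'
     + (a * x + c * y) / r * x' + (c * x + d * y) / r * y'"

lemma quad_complete_square: "a * quad a c d x y = (a * x + c * y)\<^sup>2 + (a * d - c\<^sup>2) * y\<^sup>2"
  by (simp add: quad_def power2_eq_square algebra_simps)

lemma quad_nonneg:
  assumes "0 < a" "c\<^sup>2 < a * d"
  shows "0 \<le> quad a c d x y"
proof -
  have "0 \<le> a * quad a c d x y" unfolding quad_complete_square using assms by simp
  with assms(1) show ?thesis by (simp add: zero_le_mult_iff)
qed

lemma quad_eq_0D:
  assumes "0 < a" "c\<^sup>2 < a * d" "quad a c d x y = 0"
  shows "x = 0 \<and> y = 0"
proof -
  have "(a * x + c * y)\<^sup>2 + (a * d - c\<^sup>2) * y\<^sup>2 = 0"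
    using quad_complete_square[of a c d x y] assms(3) by simp
  moreover have "0 \<le> (a * d - c\<^sup>2) * y\<^sup>2" using assms by simp
  ultimately have "(a * d - c\<^sup>2) * y\<^sup>2 = 0" "(a * x + c * y)\<^sup>2 = 0"
    by (smt (verit) zero_le_power2)+
  then show ?thesis using assms by auto
qed

text \<open>Convexity of \<open>s * ln s\<close> in tangent form, from
  \<open>ln z \<le> z - 1\<close> at \<open>z = r / s\<close>.\<close>

lemma x_ln_x_tangent:
  assumes "0 < (r::real)" "0 < s"
  shows "(ln r + 1) * (s - r) \<le> s * ln s - r * ln r"
proof -
  have "s * ln (r / s) \<le> s * (r / s - 1)"
    using assms ln_le_minus_one[of "r / s"] by simp
  then show ?thesis using assms by (simp add: ln_div algebra_simps)
qed

text \<open>Joint convexity in tangent form. For the kinetic part, the perspective of a quadratic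
  form, the gap to the tangent is itself a value of \<open>quad\<close> divided by
  \<open>2 * s\<close>.\<close>

lemma cell_density_tangent:
  assumes "0 < a" "c\<^sup>2 < a * d" "0 \<le> \<gamma>" "0 < r" "0 < s"
  shows "variation \<gamma> a c d r x y (s - r) (x' - x) (y' - y)
    \<le> cell_density \<gamma> a c d s x' y' - cell_density \<gamma> a c d r x y"
proof -
  have "0 \<le> quad a c d (x' - s / r * x) (y' - s / r * y) / (2 * s)"
    using quad_nonneg[OF assms(1,2)] assms(5) by simp
  also have "\<dots> = quad a c d x' y' / (2 * s) - quad a c d x y / (2 * r)
      - (- quad a c d x y / (2 * r\<^sup>2) * (s - r)
        + (a * x + c * y) / r * (x' - x) + (c * x + d * y) / r * (y' - y))"
    using assms(4,5) unfolding quad_def by (simp add: field_simps power2_eq_square)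
  finally have "- quad a c d x y / (2 * r\<^sup>2) * (s - r)
        + (a * x + c * y) / r * (x' - x) + (c * x + d * y) / r * (y' - y)
      \<le> quad a c d x' y' / (2 * s) - quad a c d x y / (2 * r)" by simp
  moreover have "\<gamma> * ((ln r + 1) * (s - r)) \<le> \<gamma> * (s * ln s - r * ln r)"
    using assms by (intro mult_left_mono x_ln_x_tangent)
  ultimately show ?thesis
    unfolding variation_def cell_density_def by (simp add: algebra_simps)
qed

text \<open>The second variation along a line, already written as a completed square so that its
  kernel can be read off.\<close>

lemma has_real_derivative_variation:
  assumes "0 < r"
  shows "((\<lambda>t. variation \<gamma> a c d (r + t * r') (x + t * x') (y + t * y') r' x' y')
    has_real_derivative
      quad a c d (x' - r' / r * x) (y' - r' / r * y) / r + \<gamma> * r'\<^sup>2 / r) (at 0)"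
  unfolding variation_def quad_def
  apply (rule derivative_eq_intros refl | use assms in simp; fail)+
  using assms by (simp add: field_simps power2_eq_square power4_eq_xxxx)

section \<open>The metric and its ellipticity\<close>

lemma inner_metric_at:
  "v \<bullet> (metric_at (gxx, gxy, gyy) i j *v v)
    = quad (gxx $ i $ j) (gxy $ i $ j) (gyy $ i $ j) (v $ 1) (v $ 2)"
  by (simp add: metric_at_def quad_def inner_vec_def sum_2 matrix_vector_mult_def
      power2_eq_square algebra_simps)

lemma inner_metric_at_m_bar:
  "m_bar (mx, my) i j k \<bullet> (metric_at (gxx, gxy, gyy) i j *v m_bar (mx, my) i j k)
    = quad (gxx $ i $ j) (gxy $ i $ j) (gyy $ i $ j) (mx_bar mx $ i $ j $ k) (my_bar my $ i $ j $ k)"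
  by (simp add: inner_metric_at m_bar_def)

text \<open>Sylvester's criterion for positive definiteness. In this form it consists of finitely
  many strict inequalities between entries and is visibly an open condition.\<close>

definition elliptic :: "('x::finite, 'y::finite) metric \<Rightarrow> bool" where
  "elliptic = (\<lambda>(gxx, gxy, gyy). \<forall>i j. 0 < gxx $ i $ j \<and> (gxy $ i $ j)\<^sup>2 < gxx $ i $ j * gyy $ i $ j)"

lemma elliptic_if_sym_pos_def:
  assumes "\<And>i j. sym_pos_def (metric_at g i j)"
  shows "elliptic g"
proof -
  obtain gxx gxy gyy where g: "g = (gxx, gxy, gyy)" by (cases g)
  have pos: "0 < quad (gxx $ i $ j) (gxy $ i $ j) (gyy $ i $ j) x y" if "x \<noteq> 0 \<or> y \<noteq> 0" for i j x y
  proof -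
    have "vector [x, y] \<noteq> (0 :: real ^ 2)" using that by (auto simp: vec_eq_iff forall_2)
    then show ?thesis
      using assms[of i j] inner_metric_at[of "vector [x, y]" gxx gxy gyy i j]
      unfolding sym_pos_def_def g by auto
  qed
  have "0 < gxx $ i $ j \<and> (gxy $ i $ j)\<^sup>2 < gxx $ i $ j * gyy $ i $ j" for i j
  proof -
    have a: "0 < gxx $ i $ j" using pos[of 1 0 i j] by (simp add: quad_def)
    \<comment> \<open>The test vector \<open>(- gxy, gxx)\<close> evaluates the form to
      \<open>gxx\<close> times the determinant.\<close>
    have "0 < gxx $ i $ j * (gxx $ i $ j * gyy $ i $ j - (gxy $ i $ j)\<^sup>2)"
      using pos[of "- gxy $ i $ j" "gxx $ i $ j" i j] a
      by (simp add: quad_def power2_eq_square algebra_simps)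
    with a show ?thesis by (simp add: zero_less_mult_iff)
  qed
  then show ?thesis by (simp add: elliptic_def g)
qed

subsection \<open>Linearity of the interpolations and differences\<close>

text \<open>The initial value enters only the constant part, so variations of \<open>\<rho>\<close>
  carry the initial value 0.\<close>

lemma rho_bar_affine:
  "rho_bar \<mu>0 (\<rho> + t *\<^sub>R d) = rho_bar \<mu>0 \<rho> + t *\<^sub>R rho_bar 0 d"
  by (simp add: vec_eq_iff rho_bar_def rho_at_def field_simps)

lemma D_t_affine: "D_t \<mu>0 (\<rho> + t *\<^sub>R d) = D_t \<mu>0 \<rho> + t *\<^sub>R D_t 0 d"
  by (simp add: vec_eq_iff D_t_def rho_at_def algebra_simps add_divide_distrib diff_divide_distrib)

lemma mx_at_add_scaleR: "mx_at (m + t *\<^sub>R d) i j k = mx_at m i j k + t * mx_at d i j k"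
  by (simp add: mx_at_def)

lemma my_at_add_scaleR: "my_at (m + t *\<^sub>R d) i j k = my_at m i j k + t * my_at d i j k"
  by (simp add: my_at_def)

lemma mx_bar_add_scaleR: "mx_bar (m + t *\<^sub>R d) = mx_bar m + t *\<^sub>R mx_bar d"
  by (simp add: vec_eq_iff mx_bar_def mx_at_add_scaleR field_simps)

lemma my_bar_add_scaleR: "my_bar (m + t *\<^sub>R d) = my_bar m + t *\<^sub>R my_bar d"
  by (simp add: vec_eq_iff my_bar_def my_at_add_scaleR field_simps)

lemma D_x_add_scaleR: "D_x (m + t *\<^sub>R d) = D_x m + t *\<^sub>R D_x d"
  by (simp add: vec_eq_iff D_x_def mx_at_add_scaleR algebra_simps add_divide_distrib diff_divide_distrib)

lemma D_y_add_scaleR: "D_y (m + t *\<^sub>R d) = D_y m + t *\<^sub>R D_y d"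
  by (simp add: vec_eq_iff D_y_def my_at_add_scaleR algebra_simps add_divide_distrib diff_divide_distrib)

lemma mesh_pos: "0 < mesh TYPE('n::finite)"
  by (simp add: mesh_def)

text \<open>Each average contains at least one genuine entry of \<open>\<rho>\<close>, which is
  positive; its other term may be the initial value, which may vanish.\<close>

lemma rho_bar_pos:
  assumes "\<And>i j. 0 \<le> \<mu>0 $ i $ j" "positive_arr \<rho>"
  shows "0 < rho_bar \<mu>0 \<rho> $ i $ j $ k"
proof -
  have "0 \<le> rho_at \<mu>0 \<rho> i j n" for n
    using assms by (auto simp: rho_at_def positive_arr_def less_imp_le)
  moreover have "0 < rho_at \<mu>0 \<rho> i j (Rep_cell k)"
    using assms(2) by (simp add: rho_at_def positive_arr_def Rep_cell_minus_1)
  ultimately show ?thesis by (simp add: rho_bar_def add_nonneg_pos)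
qed

subsection \<open>Zeros of the optimality system are minimizers\<close>

lemma inner_arr:
  "(v :: ('x::finite, 'y::finite, 't::finite) arr) \<bullet> w
    = (\<Sum>i\<in>UNIV. \<Sum>j\<in>UNIV. \<Sum>k\<in>UNIV. v $ i $ j $ k * w $ i $ j $ k)"
  by (simp add: inner_vec_def)

text \<open>The adjoint operators are moved onto the test direction. What results is the first
  variation of the objective per unit cell volume, minus the multiplier paired with the linearized
  constraint.\<close>

lemma Y_weak_form:
  fixes \<rho> dr :: "('x::finite, 'y::finite, 't::finite) arr"
  assumes "CARD('x) \<ge> 2" "CARD('y) \<ge> 2"
  shows "Y_rho \<gamma>I \<gamma>T \<mu>0 \<mu>1 (\<rho>, (mx, my), \<phi>) ((gxx, gxy, gyy), b) \<bullet> dr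
      + Y_mx \<mu>0 (\<rho>, (mx, my), \<phi>) ((gxx, gxy, gyy), b) \<bullet> dx
      + Y_my \<mu>0 (\<rho>, (mx, my), \<phi>) ((gxx, gxy, gyy), b) \<bullet> dy
    = - (\<phi> \<bullet> (D_t 0 dr + D_x dx + D_y dy))
      + (\<Sum>i\<in>UNIV. \<Sum>j\<in>UNIV. \<Sum>k\<in>UNIV.
          variation \<gamma>I (gxx $ i $ j) (gxy $ i $ j) (gyy $ i $ j)
            (rho_bar \<mu>0 \<rho> $ i $ j $ k) (mx_bar mx $ i $ j $ k) (my_bar my $ i $ j $ k)
            (rho_bar 0 dr $ i $ j $ k) (mx_bar dx $ i $ j $ k) (my_bar dy $ i $ j $ k))
      + (\<Sum>i\<in>UNIV. \<Sum>j\<in>UNIV. \<Sum>k\<in>UNIV. dr $ i $ j $ k * b $ i $ j)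
      + (\<Sum>i\<in>UNIV. \<Sum>j\<in>UNIV. \<gamma>T / mesh TYPE('t) *
          ((ln (\<rho> $ i $ j $ last_cell) - ln (\<mu>1 $ i $ j) + 1) * dr $ i $ j $ last_cell))"
proof -
  have last: "(\<Sum>k\<in>UNIV. (if k = last_cell then z else 0) * dr $ i $ j $ k)
      = z * dr $ i $ j $ last_cell" for z i j
    by (simp add: if_distrib[of "\<lambda>x. x * _"] cong: if_cong)
  have dist: "(b $ i $ j + (if k = last_cell then z else 0)) * dr $ i $ j $ k
      = dr $ i $ j $ k * b $ i $ j + (if k = last_cell then z else 0) * dr $ i $ j $ k" for i j k z
    by (simp add: algebra_simps)
  have load: "(\<chi> i j k. b $ i $ j + (if k = last_cell
          then \<gamma>T / mesh TYPE('t) * (ln (\<rho> $ i $ j $ last_cell) - ln (\<mu>1 $ i $ j) + 1) else 0)) \<bullet> dr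
    = (\<Sum>i\<in>UNIV. \<Sum>j\<in>UNIV. \<Sum>k\<in>UNIV. dr $ i $ j $ k * b $ i $ j)
      + (\<Sum>i\<in>UNIV. \<Sum>j\<in>UNIV. \<gamma>T / mesh TYPE('t) *
          ((ln (\<rho> $ i $ j $ last_cell) - ln (\<mu>1 $ i $ j) + 1) * dr $ i $ j $ last_cell))"
    by (simp only: inner_arr vec_lambda_beta dist sum.distrib last mult.assoc)
  show ?thesis
    unfolding Y_rho_def Y_mx_def Y_my_def prod.case inner_add_left inner_minus_left load
      Dt_adj_inner It_adj_inner Dx_adj_inner[OF assms(1)] Ix_adj_inner[OF assms(1)]
      Dy_adj_inner[OF assms(2)] Iy_adj_inner[OF assms(2)] inner_metric_at_m_bar inner_add_right
    by (simp add: inner_arr variation_def sum.distrib distrib_right)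
qed

text \<open>Taking out the space-time cell volume turns the terminal weight into
  \<open>\<gamma>T / mesh TYPE('t)\<close>, matching the weak form term by term.\<close>

lemma objective_cell_density:
  fixes \<rho> :: "('x::finite, 'y::finite, 't::finite) arr"
  shows "objective \<gamma>I \<gamma>T \<mu>0 \<mu>1 ((gxx, gxy, gyy), b) (\<rho>, (mx, my))
    = mesh TYPE('x) * mesh TYPE('y) * mesh TYPE('t) *
      ((\<Sum>i\<in>UNIV. \<Sum>j\<in>UNIV. \<Sum>k\<in>UNIV.
          cell_density \<gamma>I (gxx $ i $ j) (gxy $ i $ j) (gyy $ i $ j)
            (rho_bar \<mu>0 \<rho> $ i $ j $ k) (mx_bar mx $ i $ j $ k) (my_bar my $ i $ j $ k))
      + (\<Sum>i\<in>UNIV. \<Sum>j\<in>UNIV. \<Sum>k\<in>UNIV. \<rho> $ i $ j $ k * b $ i $ j)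
      + (\<Sum>i\<in>UNIV. \<Sum>j\<in>UNIV. \<gamma>T / mesh TYPE('t) *
          (\<rho> $ i $ j $ last_cell * (ln (\<rho> $ i $ j $ last_cell) - ln (\<mu>1 $ i $ j)))))"
  using mesh_pos[where 'n = 't]
  by (simp add: objective_def inner_metric_at_m_bar cell_density_def distrib_left
      sum_distrib_left[symmetric] sum_divide_distrib[symmetric])

text \<open>By convexity the increment of the objective between feasible points is at least the
  first variation, up to the positive cell volume. The first variation vanishes by the weak form,
  because differences of feasible points satisfy the linearized constraint.\<close>

lemma is_minimizer_if_Y_zero:
  fixes \<rho> :: "('x::finite, 'y::finite, 't::finite) arr"
  assumes card: "CARD('x) \<ge> 2" "CARD('y) \<ge> 2" and \<mu>0: "\<And>i j. 0 \<le> \<mu>0 $ i $ j"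
    and \<gamma>: "0 \<le> \<gamma>I" "0 \<le> \<gamma>T" and ell: "elliptic g" and \<rho>: "positive_arr \<rho>"
    and Y: "Y_map \<gamma>I \<gamma>T \<mu>0 \<mu>1 (\<rho>, m, \<phi>) (g, b) = 0"
  shows "is_minimizer \<gamma>I \<gamma>T \<mu>0 \<mu>1 (g, b) (\<rho>, m)"
proof -
  obtain gxx gxy gyy where g: "g = (gxx, gxy, gyy)" by (cases g)
  obtain mx my where m: "m = (mx, my)" by (cases m)
  have Y0: "Y_rho \<gamma>I \<gamma>T \<mu>0 \<mu>1 (\<rho>, (mx, my), \<phi>) ((gxx, gxy, gyy), b) = 0"
    "Y_mx \<mu>0 (\<rho>, (mx, my), \<phi>) ((gxx, gxy, gyy), b) = 0"
    "Y_my \<mu>0 (\<rho>, (mx, my), \<phi>) ((gxx, gxy, gyy), b) = 0"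
    and feas: "D_t \<mu>0 \<rho> + D_x mx + D_y my = 0"
    using Y by (auto simp: Y_map_def Y_phi_def g m zero_prod_def)
  have ineq: "objective \<gamma>I \<gamma>T \<mu>0 \<mu>1 (g, b) (\<rho>, m) \<le> objective \<gamma>I \<gamma>T \<mu>0 \<mu>1 (g, b) (\<rho>', m')"
    if "(\<rho>', m') \<in> constraint_set \<mu>0" and \<rho>': "positive_arr \<rho>'"
    for \<rho>' :: "('x, 'y, 't) arr" and m'
  proof -
    obtain mx' my' where m': "m' = (mx', my')" by (cases m')
    define dr dx dy where "dr = \<rho>' - \<rho>" and "dx = mx' - mx" and "dy = my' - my"
    have new: "\<rho>' = \<rho> + 1 *\<^sub>R dr" "mx' = mx + 1 *\<^sub>R dx" "my' = my + 1 *\<^sub>R dy"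
      by (simp_all add: dr_def dx_def dy_def)
    have "D_t \<mu>0 \<rho>' + D_x mx' + D_y my' = 0" using that m' by (simp add: constraint_set_def)
    then have "(D_t \<mu>0 \<rho> + D_x mx + D_y my) + (D_t 0 dr + D_x dx + D_y dy) = 0"
      unfolding new D_t_affine D_x_add_scaleR D_y_add_scaleR by (simp add: algebra_simps)
    then have tangent: "D_t 0 dr + D_x dx + D_y dy = 0" by (simp add: feas)
    have bars: "rho_bar 0 dr = rho_bar \<mu>0 \<rho>' - rho_bar \<mu>0 \<rho>" "mx_bar dx = mx_bar mx' - mx_bar mx"
      "my_bar dy = my_bar my' - my_bar my"
      unfolding new rho_bar_affine mx_bar_add_scaleR my_bar_add_scaleR by simp_all
    have 1: "variation \<gamma>I (gxx $ i $ j) (gxy $ i $ j) (gyy $ i $ j)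
            (rho_bar \<mu>0 \<rho> $ i $ j $ k) (mx_bar mx $ i $ j $ k) (my_bar my $ i $ j $ k)
            (rho_bar 0 dr $ i $ j $ k) (mx_bar dx $ i $ j $ k) (my_bar dy $ i $ j $ k)
      \<le> cell_density \<gamma>I (gxx $ i $ j) (gxy $ i $ j) (gyy $ i $ j)
            (rho_bar \<mu>0 \<rho>' $ i $ j $ k) (mx_bar mx' $ i $ j $ k) (my_bar my' $ i $ j $ k)
        - cell_density \<gamma>I (gxx $ i $ j) (gxy $ i $ j) (gyy $ i $ j)
            (rho_bar \<mu>0 \<rho> $ i $ j $ k) (mx_bar mx $ i $ j $ k) (my_bar my $ i $ j $ k)" for i j k
      unfolding bars vector_minus_component
      by (rule cell_density_tangent) (use ell \<gamma> rho_bar_pos[OF \<mu>0 \<rho>] rho_bar_pos[OF \<mu>0 \<rho>'] in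
          \<open>auto simp: elliptic_def g\<close>)
    have 2: "\<gamma>T / mesh TYPE('t) * ((ln (\<rho> $ i $ j $ last_cell) - ln (\<mu>1 $ i $ j) + 1) * dr $ i $ j $ last_cell)
      \<le> \<gamma>T / mesh TYPE('t) * (\<rho>' $ i $ j $ last_cell * (ln (\<rho>' $ i $ j $ last_cell) - ln (\<mu>1 $ i $ j)))
        - \<gamma>T / mesh TYPE('t) * (\<rho> $ i $ j $ last_cell * (ln (\<rho> $ i $ j $ last_cell) - ln (\<mu>1 $ i $ j)))"
      for i j
      unfolding right_diff_distrib[symmetric]
    proof (rule mult_left_mono)
      show "(ln (\<rho> $ i $ j $ last_cell) - ln (\<mu>1 $ i $ j) + 1) * dr $ i $ j $ last_cell
        \<le> \<rho>' $ i $ j $ last_cell * (ln (\<rho>' $ i $ j $ last_cell) - ln (\<mu>1 $ i $ j))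
          - \<rho> $ i $ j $ last_cell * (ln (\<rho> $ i $ j $ last_cell) - ln (\<mu>1 $ i $ j))"
        using x_ln_x_tangent[of "\<rho> $ i $ j $ last_cell" "\<rho>' $ i $ j $ last_cell"] \<rho> \<rho>'
        by (simp add: positive_arr_def dr_def algebra_simps)
    qed (use \<gamma> mesh_pos[where 'n = 't] in simp)
    have 3: "dr $ i $ j $ k * b $ i $ j = \<rho>' $ i $ j $ k * b $ i $ j - \<rho> $ i $ j $ k * b $ i $ j" for i j k
      by (simp add: dr_def algebra_simps)
    \<comment> \<open>Here \<open>x\<close>, \<open>y\<close>, \<open>z\<close> stand for the
      interior, potential and terminal parts of the first variation, each bounded by or equal to an
      increment.\<close>
    have sums: "x \<le> x' - x0 \<Longrightarrow> y = y' - y0 \<Longrightarrow> z \<le> z' - z0 \<Longrightarrow> - (\<phi> \<bullet> 0) + x + y + z = 0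
      \<Longrightarrow> x0 + y0 + z0 \<le> x' + y' + z'" for x x' x0 y y' y0 z z' z0 :: real by simp
    show ?thesis
      unfolding g m m' objective_cell_density
    proof (intro mult_left_mono, rule sums)
      show "- (\<phi> \<bullet> 0) + (\<Sum>i\<in>UNIV. \<Sum>j\<in>UNIV. \<Sum>k\<in>UNIV.
          variation \<gamma>I (gxx $ i $ j) (gxy $ i $ j) (gyy $ i $ j)
            (rho_bar \<mu>0 \<rho> $ i $ j $ k) (mx_bar mx $ i $ j $ k) (my_bar my $ i $ j $ k)
            (rho_bar 0 dr $ i $ j $ k) (mx_bar dx $ i $ j $ k) (my_bar dy $ i $ j $ k))
      + (\<Sum>i\<in>UNIV. \<Sum>j\<in>UNIV. \<Sum>k\<in>UNIV. dr $ i $ j $ k * b $ i $ j)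
      + (\<Sum>i\<in>UNIV. \<Sum>j\<in>UNIV. \<gamma>T / mesh TYPE('t) *
          ((ln (\<rho> $ i $ j $ last_cell) - ln (\<mu>1 $ i $ j) + 1) * dr $ i $ j $ last_cell)) = 0"
        using Y_weak_form[OF card, of \<gamma>I \<gamma>T \<mu>0 \<mu>1 \<rho> mx my \<phi> gxx gxy gyy b dr dx dy]
        unfolding Y0 tangent by simp
    qed (unfold sum_subtractf[symmetric], intro sum_mono 1, intro sum.cong refl 3, intro sum_mono 2,
        use mesh_pos[where 'n = 'x] mesh_pos[where 'n = 'y] mesh_pos[where 'n = 't] in simp)
  qed
  show ?thesis
    unfolding is_minimizer_def is_arg_min_def
    using ineq feas \<rho> by (fastforce simp: constraint_set_def m not_less)
qed

subsection \<open>Nondegeneracy of the optimality system\<close>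

text \<open>Each vanishing average makes the next value the negative of the previous one, and the
  recursion starts from the initial value 0.\<close>

lemma rho_bar_0_eq_0D:
  fixes d :: "('x::finite, 'y::finite, 't::finite) arr"
  assumes "rho_bar 0 d = 0"
  shows "d = 0"
proof -
  have *: "rho_at 0 d i j n = 0" if "n \<le> CARD('t)" for i j n
    using that
  proof (induction n)
    case (Suc n)
    then have R: "Rep_cell (Abs_cell (Suc n) :: 't cell) = Suc n" by (simp add: Rep_Abs_cell)
    have "rho_bar 0 d $ i $ j $ Abs_cell (Suc n) = 0" by (simp add: assms)
    then show ?case using Suc by (simp add: rho_bar_def R)
  qed (simp add: rho_at_def)
  have "d $ i $ j $ k = 0" for i j k
    using *[of "Rep_cell k" i j] Rep_cell_bounds[of k] by (simp add: rho_at_def Rep_cell_minus_1)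
  then show ?thesis by (simp add: vec_eq_iff)
qed

text \<open>The same recursion in space, started from the no-flux value at the left
  boundary.\<close>

lemma mx_bar_eq_0D:
  fixes d :: "('x::finite, 'y::finite, 't::finite) arr_x"
  assumes "2 \<le> CARD('x)" "mx_bar d = 0"
  shows "d = 0"
proof -
  have *: "mx_at d n j k = 0" if "n \<le> CARD('x)" for n j k
    using that
  proof (induction n)
    case (Suc n)
    then have R: "Rep_cell (Abs_cell (Suc n) :: 'x cell) = Suc n" by (simp add: Rep_Abs_cell)
    have "mx_bar d $ Abs_cell (Suc n) $ j $ k = 0" by (simp add: assms)
    then show ?case using Suc by (simp add: mx_bar_def R)
  qed (simp add: mx_at_def)
  have "d $ i $ j $ k = 0" for i j k
    using *[of "Rep_face i" j k] Rep_face_bounds[OF assms(1), of i]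
    by (simp add: mx_at_def Rep_face_inverse)
  then show ?thesis by (simp add: vec_eq_iff)
qed

lemma my_bar_eq_0D:
  fixes d :: "('x::finite, 'y::finite, 't::finite) arr_y"
  assumes "2 \<le> CARD('y)" "my_bar d = 0"
  shows "d = 0"
proof -
  have *: "my_at d i n k = 0" if "n \<le> CARD('y)" for n i k
    using that
  proof (induction n)
    case (Suc n)
    then have R: "Rep_cell (Abs_cell (Suc n) :: 'y cell) = Suc n" by (simp add: Rep_Abs_cell)
    have "my_bar d $ i $ Abs_cell (Suc n) $ k = 0" by (simp add: assms)
    then show ?case using Suc by (simp add: my_bar_def R)
  qed (simp add: my_at_def)
  have "d $ i $ j $ k = 0" for i j k
    using *[of "Rep_face j" i k] Rep_face_bounds[OF assms(1), of j]
    by (simp add: my_at_def Rep_face_inverse)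
  then show ?thesis by (simp add: vec_eq_iff)
qed

lemma Dt_adj_eq_0D:
  fixes w :: "('x::finite, 'y::finite, 't::finite) arr"
  assumes "Dt_adj w = 0"
  shows "w = 0"
proof -
  note mesh = mesh_pos[where 'n = 't]
  \<comment> \<open>\<open>n\<close> counts time steps backwards: the last entry vanishes by the
    terminal case of \<open>Dt_adj\<close>, and each earlier one equals its successor.\<close>
  have *: "w $ i $ j $ k = 0" if "Rep_cell k = CARD('t) - n" "n < CARD('t)" for i j k n
    using that
  proof (induction n arbitrary: k)
    case 0
    then have "k = last_cell" by (metis Rep_cell_inject Rep_last_cell diff_zero)
    moreover have "Dt_adj w $ i $ j $ last_cell = 0" by (simp add: assms)
    ultimately show ?case using mesh by (simp add: Dt_adj_def)
  next
    case (Suc n)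
    then have k: "k \<noteq> last_cell" by (auto simp: not_last_cell)
    then have "w $ i $ j $ succ_cell k = 0" using Suc by (simp add: Rep_succ_cell)
    moreover have "Dt_adj w $ i $ j $ k = 0" by (simp add: assms)
    ultimately show ?case using mesh k by (simp add: Dt_adj_def)
  qed
  have "w $ i $ j $ k = 0" for i j k
    using *[of k "CARD('t) - Rep_cell k" i j] Rep_cell_bounds[of k] by simp
  then show ?thesis by (simp add: vec_eq_iff)
qed

text \<open>Restricting to the line through the point in direction \<open>h\<close> reduces
  everything to functions of one real variable, without an explicit formula for
  \<open>D\<close>.\<close>

lemma Y_derivative_eq_0D:
  fixes \<rho> :: "('x::finite, 'y::finite, 't::finite) arr"
  assumes card: "CARD('x) \<ge> 2" "CARD('y) \<ge> 2" and \<mu>0: "\<And>i j. 0 \<le> \<mu>0 $ i $ j"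
    and \<gamma>: "0 < \<gamma>I" "0 \<le> \<gamma>T" and ell: "elliptic g" and \<rho>: "positive_arr \<rho>"
    and D: "((\<lambda>u. Y_map \<gamma>I \<gamma>T \<mu>0 \<mu>1 u (g, b)) has_derivative D) (at (\<rho>, m, \<phi>))"
    and D0: "D h = 0"
  shows "h = 0"
proof -
  obtain gxx gxy gyy where g: "g = (gxx, gxy, gyy)" by (cases g)
  obtain mx my where m: "m = (mx, my)" by (cases m)
  obtain dr dx dy df where h: "h = (dr, (dx, dy), df)" by (metis prod.collapse)
  define u where "u = (\<lambda>t::real. (\<rho> + t *\<^sub>R dr, (mx + t *\<^sub>R dx, my + t *\<^sub>R dy), \<phi> + t *\<^sub>R df))"
  define y where "y = (\<lambda>t. Y_map \<gamma>I \<gamma>T \<mu>0 \<mu>1 (u t) (g, b))"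
  have "((\<lambda>t. (\<rho>, m, \<phi>) + t *\<^sub>R h) has_derivative (\<lambda>t. t *\<^sub>R h)) (at 0)"
    by (auto intro!: derivative_eq_intros)
  then have "((\<lambda>t. Y_map \<gamma>I \<gamma>T \<mu>0 \<mu>1 ((\<rho>, m, \<phi>) + t *\<^sub>R h) (g, b)) has_derivative
      (\<lambda>t. D (t *\<^sub>R h))) (at 0)"
    by (rule has_derivative_compose) (simp add: D)
  moreover have "D (t *\<^sub>R h) = 0" for t
    using linear_scale[OF has_derivative_linear[OF D]] D0 by simp
  ultimately have y': "(y has_derivative (\<lambda>_. 0)) (at 0)"
    unfolding y_def u_def by (simp add: h m)
  have y_eq: "y t = (Y_rho \<gamma>I \<gamma>T \<mu>0 \<mu>1 (u t) (g, b), (Y_mx \<mu>0 (u t) (g, b), Y_my \<mu>0 (u t) (g, b)),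
      Y_phi \<mu>0 (u t))" for t by (simp add: y_def Y_map_def)

  \<comment> \<open>The constraint is affine, so its derivative along the line is the linearized
    constraint applied to the direction.\<close>
  have "((\<lambda>t. snd (snd (y t))) has_derivative (\<lambda>_. 0)) (at 0)"
    using has_derivative_snd[OF has_derivative_snd[OF y']] by simp
  moreover have "snd (snd (y t)) = D_t \<mu>0 \<rho> + D_x mx + D_y my + t *\<^sub>R (D_t 0 dr + D_x dx + D_y dy)" for t
    by (simp add: y_eq u_def Y_phi_def D_t_affine D_x_add_scaleR D_y_add_scaleR algebra_simps)
  moreover have "((\<lambda>t. D_t \<mu>0 \<rho> + D_x mx + D_y my + t *\<^sub>R (D_t 0 dr + D_x dx + D_y dy))
      has_derivative (\<lambda>t. t *\<^sub>R (D_t 0 dr + D_x dx + D_y dy))) (at 0)"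
    by (auto intro!: derivative_eq_intros)
  ultimately have "(\<lambda>_. 0) = (\<lambda>t::real. t *\<^sub>R (D_t 0 dr + D_x dx + D_y dy))"
    by (auto intro: has_derivative_unique)
  from fun_cong[OF this, of 1] have tangent: "D_t 0 dr + D_x dx + D_y dy = 0" by simp

  define R where "R = (\<lambda>i j k. rho_bar \<mu>0 \<rho> $ i $ j $ k)"
  define R' where "R' = (\<lambda>i j k. rho_bar 0 dr $ i $ j $ k)"
  \<comment> \<open>\<open>Q\<close> and \<open>E\<close> are the interior and terminal
    contributions to the second variation.\<close>
  define Q where "Q = (\<lambda>i j k. quad (gxx $ i $ j) (gxy $ i $ j) (gyy $ i $ j)
      (mx_bar dx $ i $ j $ k - R' i j k / R i j k * mx_bar mx $ i $ j $ k)
      (my_bar dy $ i $ j $ k - R' i j k / R i j k * my_bar my $ i $ j $ k) / R i j k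
    + \<gamma>I * (R' i j k)\<^sup>2 / R i j k)"
  define E where "E = (\<lambda>i j. \<gamma>T / mesh TYPE('t) * ((dr $ i $ j $ last_cell)\<^sup>2 / \<rho> $ i $ j $ last_cell))"
  have Rpos: "0 < R i j k" for i j k unfolding R_def by (rule rho_bar_pos[OF \<mu>0 \<rho>])
  define G where "G = (\<lambda>t. fst (y t) \<bullet> dr + fst (fst (snd (y t))) \<bullet> dx + snd (fst (snd (y t))) \<bullet> dy)"
  note y'_fst = has_derivative_fst[OF y'] has_derivative_fst[OF has_derivative_snd[OF y']]
  have "(G has_derivative (\<lambda>_. 0)) (at 0)"
    using has_derivative_add[OF has_derivative_add[OF has_derivative_inner_left[OF y'_fst(1), of dr]
        has_derivative_inner_left[OF has_derivative_fst[OF y'_fst(2)], of dx]]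
        has_derivative_inner_left[OF has_derivative_snd[OF y'_fst(2)], of dy]]
    by (simp add: G_def)
  then have G0: "(G has_real_derivative 0) (at 0)" by (simp add: has_field_derivative_def lambda_zero)
  \<comment> \<open>The multiplier term drops out for every \<open>t\<close>, although
    \<open>\<phi>\<close> also moves along the line, because the direction satisfies the linearized
    constraint.\<close>
  have G_eq: "G = (\<lambda>t. (\<Sum>i\<in>UNIV. \<Sum>j\<in>UNIV. \<Sum>k\<in>UNIV.
          variation \<gamma>I (gxx $ i $ j) (gxy $ i $ j) (gyy $ i $ j)
            (R i j k + t * R' i j k) (mx_bar mx $ i $ j $ k + t * mx_bar dx $ i $ j $ k)
            (my_bar my $ i $ j $ k + t * my_bar dy $ i $ j $ k)
            (R' i j k) (mx_bar dx $ i $ j $ k) (my_bar dy $ i $ j $ k))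
      + (\<Sum>i\<in>UNIV. \<Sum>j\<in>UNIV. \<Sum>k\<in>UNIV. dr $ i $ j $ k * b $ i $ j)
      + (\<Sum>i\<in>UNIV. \<Sum>j\<in>UNIV. \<gamma>T / mesh TYPE('t) *
          ((ln (\<rho> $ i $ j $ last_cell + t * dr $ i $ j $ last_cell) - ln (\<mu>1 $ i $ j) + 1)
            * dr $ i $ j $ last_cell)))"
    unfolding G_def y_eq u_def g
    by (simp add: Y_weak_form[OF card] tangent R_def R'_def rho_bar_affine mx_bar_add_scaleR
        my_bar_add_scaleR)
  have log': "((\<lambda>t. c * ((ln (r + t * s) - l + 1) * s)) has_real_derivative c * (s\<^sup>2 / r)) (at 0)"
    if "0 < r" for c r s l :: real
    using that by (auto intro!: derivative_eq_intros simp: power2_eq_square)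
  have \<rho>_last: "0 < \<rho> $ i $ j $ last_cell" for i j using \<rho> by (simp add: positive_arr_def)
  have "(G has_real_derivative
      (\<Sum>i\<in>UNIV. \<Sum>j\<in>UNIV. \<Sum>k\<in>UNIV. Q i j k) + 0 + (\<Sum>i\<in>UNIV. \<Sum>j\<in>UNIV. E i j)) (at 0)"
    unfolding G_eq Q_def E_def
    by (intro DERIV_add DERIV_sum DERIV_const has_real_derivative_variation Rpos log' \<rho>_last)
  then have "(\<Sum>i\<in>UNIV. \<Sum>j\<in>UNIV. \<Sum>k\<in>UNIV. Q i j k) + 0 + (\<Sum>i\<in>UNIV. \<Sum>j\<in>UNIV. E i j) = 0"
    using G0 by (rule DERIV_unique)
  moreover have "0 \<le> E i j" for i j
    using \<gamma> \<rho> mesh_pos[where 'n = 't] by (simp add: E_def positive_arr_def less_imp_le)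
  then have "0 \<le> (\<Sum>i\<in>UNIV. \<Sum>j\<in>UNIV. E i j)" by (intro sum_nonneg)
  moreover have quad0: "0 \<le> quad (gxx $ i $ j) (gxy $ i $ j) (gyy $ i $ j) v w" for i j v w
    using ell by (intro quad_nonneg) (auto simp: elliptic_def g)
  have Q0: "0 \<le> Q i j k" for i j k
    using \<gamma> Rpos[of i j k] quad0 by (simp add: Q_def)
  ultimately have "(\<Sum>i\<in>UNIV. \<Sum>j\<in>UNIV. \<Sum>k\<in>UNIV. Q i j k) = 0"
    by (smt (verit) sum_nonneg)
  then have Qz: "Q i j k = 0" for i j k
    by (simp add: sum_nonneg_eq_0_iff Q0 sum_nonneg)
  have bars: "R' i j k = 0 \<and> mx_bar dx $ i $ j $ k = 0 \<and> my_bar dy $ i $ j $ k = 0" for i j k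
  proof -
    note r = Rpos[of i j k]
    have "0 \<le> quad (gxx $ i $ j) (gxy $ i $ j) (gyy $ i $ j)
      (mx_bar dx $ i $ j $ k - R' i j k / R i j k * mx_bar mx $ i $ j $ k)
      (my_bar dy $ i $ j $ k - R' i j k / R i j k * my_bar my $ i $ j $ k) / R i j k"
      using quad0 r by simp
    moreover have "0 \<le> \<gamma>I * (R' i j k)\<^sup>2 / R i j k" using \<gamma> r by simp
    ultimately have "\<gamma>I * (R' i j k)\<^sup>2 / R i j k = 0" and q: "quad (gxx $ i $ j) (gxy $ i $ j) (gyy $ i $ j)
      (mx_bar dx $ i $ j $ k - R' i j k / R i j k * mx_bar mx $ i $ j $ k)
      (my_bar dy $ i $ j $ k - R' i j k / R i j k * my_bar my $ i $ j $ k) / R i j k = 0"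
      using Qz[of i j k] unfolding Q_def by linarith+
    \<comment> \<open>Strict positivity of \<open>\<gamma>I\<close> enters here; once
      \<open>R'\<close> vanishes, the completed square involves the momentum variations
      alone.\<close>
    then have R': "R' i j k = 0" using \<gamma> r by simp
    with q r have "quad (gxx $ i $ j) (gxy $ i $ j) (gyy $ i $ j)
      (mx_bar dx $ i $ j $ k) (my_bar dy $ i $ j $ k) = 0" by simp
    from quad_eq_0D[OF _ _ this] R' ell show ?thesis by (auto simp: elliptic_def g)
  qed
  have dr: "dr = 0" by (rule rho_bar_0_eq_0D) (use bars in \<open>simp add: vec_eq_iff R'_def\<close>)
  have dx: "dx = 0" by (rule mx_bar_eq_0D[OF card(1)]) (use bars in \<open>simp add: vec_eq_iff\<close>)
  have dy: "dy = 0" by (rule my_bar_eq_0D[OF card(2)]) (use bars in \<open>simp add: vec_eq_iff\<close>)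

  \<comment> \<open>Only the multiplier still moves, so the first component of \<open>y\<close> is
    affine in \<open>t\<close> with slope \<open>- Dt_adj df\<close>.\<close>
  have lin: "Dt_adj (\<phi> + t *\<^sub>R df) = Dt_adj \<phi> + t *\<^sub>R Dt_adj df" for t
    by (simp add: vec_eq_iff Dt_adj_def algebra_simps add_divide_distrib diff_divide_distrib)
  have "((\<lambda>t. fst (y t)) has_derivative (\<lambda>_. 0)) (at 0)"
    using has_derivative_fst[OF y'] by simp
  moreover have "fst (y t) = fst (y 0) - t *\<^sub>R Dt_adj df" for t
    by (simp add: y_eq u_def dr dx dy Y_rho_def g lin)
  moreover have "((\<lambda>t. fst (y 0) - t *\<^sub>R Dt_adj df) has_derivative (\<lambda>t. - (t *\<^sub>R Dt_adj df))) (at 0)"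
    by (auto intro!: derivative_eq_intros)
  ultimately have "(\<lambda>_. 0) = (\<lambda>t::real. - (t *\<^sub>R Dt_adj df))"
    by (metis (no_types, lifting) ext has_derivative_unique)
  from fun_cong[OF this, of 1] have "Dt_adj df = 0" by simp
  then show ?thesis unfolding h dr dx dy by (simp add: Dt_adj_eq_0D zero_prod_def)
qed

subsection \<open>Smoothness of the optimality system\<close>

text \<open>The condition does not depend on \<open>x\<close>; it serves for tests on indices, such
  as boundary cells or the last time step.\<close>

lemma C1_map_on_if:
  "(c \<Longrightarrow> C1_map_on S f) \<Longrightarrow> (\<not> c \<Longrightarrow> C1_map_on S g) \<Longrightarrow> C1_map_on S (\<lambda>x. if c then f x else g x)"
  by (cases c) simp_all

lemma C1_map_on_rho_at:
  "C1_map_on S f \<Longrightarrow> C1_map_on S (\<lambda>x::'a::euclidean_space. rho_at \<mu>0 (f x) i j n)"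
  unfolding rho_at_def by (intro C1_map_on_intros C1_map_on_if)

lemma C1_map_on_mx_at:
  "C1_map_on S f \<Longrightarrow> C1_map_on S (\<lambda>x::'a::euclidean_space. mx_at (f x) i j k)"
  unfolding mx_at_def by (intro C1_map_on_intros C1_map_on_if)

lemma C1_map_on_my_at:
  "C1_map_on S f \<Longrightarrow> C1_map_on S (\<lambda>x::'a::euclidean_space. my_at (f x) i j k)"
  unfolding my_at_def by (intro C1_map_on_intros C1_map_on_if)

lemmas C1_map_on_at_intros = C1_map_on_intros C1_map_on_if C1_map_on_rho_at C1_map_on_mx_at C1_map_on_my_at

lemma C1_map_on_grid_operators:
  fixes f :: "'a::euclidean_space \<Rightarrow> ('x::finite, 'y::finite, 't::finite) arr"
  assumes "C1_map_on S f"
  shows "C1_map_on S (\<lambda>x. rho_bar \<mu>0 (f x))" "C1_map_on S (\<lambda>x. D_t \<mu>0 (f x))"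
    "C1_map_on S (\<lambda>x. It_adj (f x))" "C1_map_on S (\<lambda>x. Ix_adj (f x))"
    "C1_map_on S (\<lambda>x. Iy_adj (f x))" "C1_map_on S (\<lambda>x. Dt_adj (f x))"
    "C1_map_on S (\<lambda>x. Dx_adj (f x))" "C1_map_on S (\<lambda>x. Dy_adj (f x))"
  unfolding rho_bar_def D_t_def It_adj_def Ix_adj_def Iy_adj_def Dt_adj_def Dx_adj_def Dy_adj_def
  by (intro C1_map_on_at_intros assms)+

lemma C1_map_on_grid_operators_x:
  fixes f :: "'a::euclidean_space \<Rightarrow> ('x::finite, 'y::finite, 't::finite) arr_x"
  assumes "C1_map_on S f"
  shows "C1_map_on S (\<lambda>x. mx_bar (f x))" "C1_map_on S (\<lambda>x. D_x (f x))"
  unfolding mx_bar_def D_x_def by (intro C1_map_on_at_intros assms)+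

lemma C1_map_on_grid_operators_y:
  fixes f :: "'a::euclidean_space \<Rightarrow> ('x::finite, 'y::finite, 't::finite) arr_y"
  assumes "C1_map_on S f"
  shows "C1_map_on S (\<lambda>x. my_bar (f x))" "C1_map_on S (\<lambda>x. D_y (f x))"
  unfolding my_bar_def D_y_def by (intro C1_map_on_at_intros assms)+

lemma C1_map_on_Y:
  fixes S :: "(('x::finite, 'y::finite) param \<times> ('x, 'y, 't::finite) unknown) set"
  assumes \<mu>0: "\<And>i j. 0 \<le> \<mu>0 $ i $ j" and S: "\<And>p u. (p, u) \<in> S \<Longrightarrow> positive_arr (fst u)"
  shows "C1_map_on S (\<lambda>x. Y_map \<gamma>I \<gamma>T \<mu>0 \<mu>1 (snd x) (fst x))"
proof -
  \<comment> \<open>Written with projections and products only, the quadratic form can be decomposed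
    by the closure rules.\<close>
  have quad: "m_bar m i j k \<bullet> (metric_at g i j *v m_bar m i j k)
    = fst g $ i $ j * (mx_bar (fst m) $ i $ j $ k * mx_bar (fst m) $ i $ j $ k)
      + 2 * (fst (snd g) $ i $ j * (mx_bar (fst m) $ i $ j $ k * my_bar (snd m) $ i $ j $ k))
      + snd (snd g) $ i $ j * (my_bar (snd m) $ i $ j $ k * my_bar (snd m) $ i $ j $ k)"
    for g :: "('x, 'y) metric" and m :: "('x, 'y, 't) mom" and i j k
    using inner_metric_at_m_bar[of "fst m" "snd m" i j k "fst g" "fst (snd g)" "snd (snd g)"]
    by (simp add: quad_def power2_eq_square mult.assoc)
  have \<rho>: "0 < fst (snd x) $ i $ j $ k" if "x \<in> S" for x i j k
    using S[of "fst x" "snd x"] that by (simp add: positive_arr_def)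
  have \<rho>b: "0 < rho_bar \<mu>0 (fst (snd x)) $ i $ j $ k" if "x \<in> S" for x i j k
    using S[of "fst x" "snd x"] that by (intro rho_bar_pos \<mu>0) simp
  show ?thesis
    unfolding Y_map_def Y_rho_def Y_mx_def Y_my_def Y_phi_def case_prod_beta quad power2_eq_square
    by (intro C1_map_on_intros C1_map_on_if C1_map_on_ln C1_map_on_divide
        C1_map_on_grid_operators C1_map_on_grid_operators_x C1_map_on_grid_operators_y \<rho> \<rho>b)
       (use \<rho>b in \<open>simp_all add: less_imp_neq[symmetric]\<close>)
qed

section \<open>Openness of the domain and conclusion\<close>

lemma open_positive_arr: "open {\<rho> :: ('x::finite, 'y::finite, 't::finite) arr. positive_arr \<rho>}"
  unfolding positive_arr_def Collect_all_eq
  by (intro open_INT finite ballI open_Collect_less continuous_intros)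

lemma open_elliptic: "open {g :: ('x::finite, 'y::finite) metric. elliptic g}"
  unfolding elliptic_def case_prod_beta Collect_all_eq
  by (intro open_INT finite ballI open_Collect_conj open_Collect_less continuous_intros)

text \<open>The partial derivatives \<open>DuY\<close> and \<open>DpY\<close> are unique, so the
  existential expresses the formula for the derivative of \<open>T\<close>.\<close>

theorem theorem3p8:
  fixes \<gamma>I \<gamma>T :: real
    and \<mu>0 \<mu>1 :: "('x::finite, 'y::finite) field"
    and g :: "('x, 'y) metric" and b :: "('x, 'y) field"
    and \<rho> :: "('x, 'y, 't::finite) arr" and m :: "('x, 'y, 't) mom" and \<phi> :: "('x, 'y, 't) arr"
  assumes "CARD('x) \<ge> 2" and "CARD('y) \<ge> 2" and "CARD('t) \<ge> 1"
    and "\<And>i j. \<mu>0 $ i $ j \<ge> 0" and "\<And>i j. \<mu>1 $ i $ j > 0"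
    and "\<gamma>I > 0" and "\<gamma>T > 0"
    and "\<And>i j. sym_pos_def (metric_at g i j)"
    and "is_minimizer \<gamma>I \<gamma>T \<mu>0 \<mu>1 (g, b) (\<rho>, m)"
    and "positive_arr \<rho>"
    and "Y_map \<gamma>I \<gamma>T \<mu>0 \<mu>1 (\<rho>, m, \<phi>) (g, b) = 0"
  shows "\<exists>ru>0. \<exists>rl>0. \<exists>T :: ('x, 'y) param \<Rightarrow> ('x, 'y, 't) unknown.
      (\<forall>p \<in> ball (g, b) ru.
         T p \<in> ball (\<rho>, m, \<phi>) rl \<and> solves_forward \<gamma>I \<gamma>T \<mu>0 \<mu>1 p (T p) \<and>
         (\<forall>u \<in> ball (\<rho>, m, \<phi>) rl. solves_forward \<gamma>I \<gamma>T \<mu>0 \<mu>1 p u \<longrightarrow> u = T p)) \<and>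
      T (g, b) = (\<rho>, m, \<phi>) \<and>
      C1_map_on (ball (g, b) ru) T \<and>
      (\<forall>p \<in> ball (g, b) ru. \<exists>DuY DpY.
         ((\<lambda>u. Y_map \<gamma>I \<gamma>T \<mu>0 \<mu>1 u p) has_derivative DuY) (at (T p)) \<and>
         ((\<lambda>q. Y_map \<gamma>I \<gamma>T \<mu>0 \<mu>1 (T p) q) has_derivative DpY) (at p) \<and>
         bij DuY \<and>
         (T has_derivative (\<lambda>h. - inv DuY (DpY h))) (at p))"
proof -
  \<comment> \<open>Since both balls lie in \<open>U\<close>, every zero found there has an elliptic
    metric and a positive density and is therefore a minimizer.\<close>
  define U :: "(('x, 'y) param \<times> ('x, 'y, 't) unknown) set" where
    "U = ({g. elliptic g} \<times> UNIV) \<times> ({\<rho>. positive_arr \<rho>} \<times> UNIV)"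
  let ?Y = "\<lambda>x. Y_map \<gamma>I \<gamma>T \<mu>0 \<mu>1 (snd x) (fst x)"
  have ell: "elliptic g" using assms(8) by (rule elliptic_if_sym_pos_def)
  have "open U" unfolding U_def
    by (intro open_Times open_elliptic open_positive_arr open_UNIV)
  moreover have "C1_map_on U ?Y"
    by (rule C1_map_on_Y) (use assms(4) in \<open>auto simp: U_def\<close>)
  moreover have "((g, b), (\<rho>, m, \<phi>)) \<in> U" using ell assms(10) by (simp add: U_def)
  moreover have "?Y ((g, b), (\<rho>, m, \<phi>)) = 0" using assms(11) by simp
  moreover have "k = 0" if "((\<lambda>u. ?Y ((g, b), u)) has_derivative D) (at (\<rho>, m, \<phi>))" "D k = 0" for D k
    by (rule Y_derivative_eq_0D[OF assms(1,2,4,6) less_imp_le[OF assms(7)] ell assms(10)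
          that(1)[unfolded fst_conv snd_conv] that(2)])
  ultimately show ?thesis
  proof (rule implicit_function_theorem)
    fix ru rl :: real and T
    assume "ru > 0" "rl > 0" and sub: "ball (g, b) ru \<times> ball (\<rho>, m, \<phi>) rl \<subseteq> U"
      and ball: "\<And>p. p \<in> ball (g, b) ru \<Longrightarrow> T p \<in> ball (\<rho>, m, \<phi>) rl"
      and zero: "\<And>p. p \<in> ball (g, b) ru \<Longrightarrow> ?Y (p, T p) = 0"
      and unique: "\<And>p u. p \<in> ball (g, b) ru \<Longrightarrow> u \<in> ball (\<rho>, m, \<phi>) rl \<Longrightarrow> ?Y (p, u) = 0 \<Longrightarrow> u = T p"
      and base: "T (g, b) = (\<rho>, m, \<phi>)" and C1: "C1_map_on (ball (g, b) ru) T"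
      and der: "\<And>p. p \<in> ball (g, b) ru \<Longrightarrow> \<exists>DuY DpY. ((\<lambda>u. ?Y (p, u)) has_derivative DuY) (at (T p)) \<and>
             ((\<lambda>q. ?Y (q, T p)) has_derivative DpY) (at p) \<and> bij DuY \<and>
             (T has_derivative (\<lambda>h. - inv DuY (DpY h))) (at p)"
    have solves: "solves_forward \<gamma>I \<gamma>T \<mu>0 \<mu>1 p (T p)" if p: "p \<in> ball (g, b) ru" for p
    proof -
      obtain g' b' \<rho>' m' \<phi>' where eq: "p = (g', b')" "T p = (\<rho>', m', \<phi>')" by (metis prod.collapse)
      have "(p, T p) \<in> U" using sub ball[OF p] p by auto
      then have "elliptic g'" "positive_arr \<rho>'"
        unfolding eq(2) unfolding eq(1) by (auto simp: U_def)
      moreover have "Y_map \<gamma>I \<gamma>T \<mu>0 \<mu>1 (\<rho>', m', \<phi>') (g', b') = 0" 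
        using zero[OF p] unfolding eq(2) unfolding eq(1) by simp
      ultimately show ?thesis
        using is_minimizer_if_Y_zero[OF assms(1,2,4) less_imp_le[OF assms(6)] less_imp_le[OF assms(7)]]
        unfolding solves_forward_def eq(2) unfolding eq(1) by simp
    qed
    \<comment> \<open>Solutions of the forward problem are zeros of \<open>Y_map\<close>, so
      uniqueness of zeros carries over.\<close>
    have uniq: "u = T p" if "p \<in> ball (g, b) ru" "u \<in> ball (\<rho>, m, \<phi>) rl" "solves_forward \<gamma>I \<gamma>T \<mu>0 \<mu>1 p u" for p u
      using that by (intro unique) (auto simp: solves_forward_def)
    show ?thesis
      by (intro exI[of _ ru] exI[of _ rl] exI[of _ T] conjI ballI impI ball solves uniq base C1
          der[unfolded fst_conv snd_conv] \<open>ru > 0\<close> \<open>rl > 0\<close>)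
  qed
qed

end
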